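(* Let $a,b,c\in\mathbb{R}$ with $0<b<\min(a,c-a)$. Then the inverse Fourier transform $$h(y)=\frac{1}{\sqrt{2\pi}}\int_{-\infty}^{\infty}(i\omega+0)^{b-1}M(a,c;i\omega)\,e^{-i\omega y}\,d\omega$$ is given by $$h(y)=\begin{cases}0, & y>1,\\[1ex] \sqrt{2\pi}\,\dfrac{\Gamma(c)}{\Gamma(a)\,\Gamma(1-a-b+c)}\,y^{a-b}(1-y)^{c-a-b}\,F\big(1-b,\,c-b;\,c+1-a-b;\,1-y\big), & 0<y<1,\\[2ex] \dfrac{\sqrt{2\pi}}{\Gamma(1-b)}\,\dfrac{1}{(1-y)^{b}}\,F\!\left(b,\,c-a;\,c;\,\dfrac{1}{1-y}\right), & y<0.\end{cases}$$
   Context: $M(a,c;z)=\sum_{k\ge0}\frac{(a)_k}{(c)_k}\frac{z^k}{k!}$ is the confluent hypergeometric (Kummer) function and $F(a,b;c;z)$ is the Gauss hypergeometric function ${}_2F_1$. For real $\omega\ne0$, $(i\omega+0)^{b-1}=(i\omega)^{b-1}$ with the principal branch: $(i\omega)^{b-1}=|\omega|^{b-1}e^{i\pi(b-1)\mathrm{sgn}(\omega)/2}$. $1/\Gamma(1-b)$ is taken to be $0$ when $b$ is a positive integer. *)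

theory Defs
  imports "HOL-Analysis.Analysis"
begin

definition kummer_M :: "'a \<Rightarrow> 'a \<Rightarrow> 'a \<Rightarrow> 'a::{real_normed_field,banach}" where
  "kummer_M a c z = (\<Sum>k. pochhammer a k / pochhammer c k * (z ^ k / fact k))"

(* Meaningful only inside the disc of convergence norm z < 1; no analytic continuation. *)
definition gauss_F :: "'a \<Rightarrow> 'a \<Rightarrow> 'a \<Rightarrow> 'a \<Rightarrow> 'a::{real_normed_field,banach}" where
  "gauss_F a b c z =
     (\<Sum>k. pochhammer a k * pochhammer b k / pochhammer c k * (z ^ k / fact k))"

definition fourier_integrand :: "(real \<Rightarrow> complex) \<Rightarrow> real \<Rightarrow> real \<Rightarrow> complex" where
  "fourier_integrand g y \<omega> = g \<omega> * exp (- (\<i> * of_real \<omega> * of_real y))"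

(* Sign convention: the inverse transform is the one with kernel exp (-i w y). *)
definition inverse_fourier :: "(real \<Rightarrow> complex) \<Rightarrow> real \<Rightarrow> complex" where
  "inverse_fourier g y =
     1 / of_real (sqrt (2 * pi)) * (LINT \<omega>|lborel. fourier_integrand g y \<omega>)"

(* powr is the principal branch; its value 0 at w = 0 only affects a null set. *)
definition kummer_symbol :: "real \<Rightarrow> real \<Rightarrow> real \<Rightarrow> real \<Rightarrow> complex" where
  "kummer_symbol a b c \<omega> =
     (\<i> * of_real \<omega>) powr of_real (b - 1) * kummer_M (of_real a) (of_real c) (\<i> * of_real \<omega>)"

end

theory Submission
  imports Defs
begin

text \<open>For \<open>0 < b < 1\<close>, \<open>M\<close> is the Fourier transform of a Beta density \<open>f\<close> on \<open>[0, 1]\<close>, and the damping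
  factor \<open>exp (- \<epsilon> |\<omega>|)\<close> makes Fubini applicable: the transform becomes the integral of \<open>f\<close> against an
  explicit kernel which tends to \<open>2 \<pi> (t - y)\<^sup>-\<^sup>b / \<Gamma>(1 - b)\<close> for \<open>t > y\<close> and to \<open>0\<close> for \<open>t < y\<close>. The resulting
  Euler integrals are the stated Gauss functions. The case \<open>b = 1\<close> follows by continuity in \<open>b\<close>. For
  \<open>b > 1\<close>, the relation \<open>z M(a, c; z) = (c - 1) (M(a, c - 1; z) - M(a - 1, c - 1; z))\<close> lowers \<open>b\<close> by one,
  and contiguous relations for \<open>F\<close> show that the closed form satisfies the same recursion.\<close>

section \<open>Kummer and Gauss series\<close>

text \<open>The damping is needed because |\<omega>|^(b - 1) is not integrable at infinity, so the
  undamped double integral does not converge absolutely. Removing it on the frequency side requires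
  the symbol itself to be integrable, that is, the decay M(a, c; i\<omega>) = O(|\<omega>|^(-min(a,
  c - a))); this is where b < min(a, c - a) enters. Removing it on the other side requires |t -
  y|^(-b) to be locally integrable, which confines the direct argument to b < 1. The recursion sends
  (a, b, c) to (a, b - 1, c - 1) and (a - 1, b - 1, c - 1), and for b > 1 both triples satisfy the
  hypotheses again. At b = 1 it would land on b = 0, outside the range, so that case needs a limit
  of its own.\<close>

lemma pochhammer_mono:
  fixes x y :: real
  assumes "0 \<le> x" "x \<le> y"
  shows "pochhammer x k \<le> pochhammer y k"
  using assms by (auto simp: pochhammer_prod intro!: prod_mono)

lemma abs_pochhammer_le:
  fixes x :: real
  assumes "\<bar>x\<bar> \<le> y"
  shows "\<bar>pochhammer x k\<bar> \<le> pochhammer y k"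
  using assms by (auto simp: pochhammer_prod abs_prod intro!: prod_mono)

text \<open>Turns the moments of a Beta density into Pochhammer ratios: the bridge between Euler
  integrals and the Kummer and Gauss series.\<close>

lemma Beta_add_of_nat_left:
  fixes a b :: real
  assumes "a > 0" "b > 0"
  shows "Beta (a + of_nat k) b = Beta a b * pochhammer a k / pochhammer (a + b) k"
proof -
  have "a \<notin> \<int>\<^sub>\<le>\<^sub>0" "a + b \<notin> \<int>\<^sub>\<le>\<^sub>0" using assms by (auto elim!: nonpos_Ints_cases)
  moreover have "Gamma a > 0" "Gamma (a + b) > 0" "Gamma (a + b + real k) > 0"
    using assms by auto
  ultimately show ?thesis
    by (simp add: pochhammer_Gamma Beta_def field_simps add_ac)
qed

text \<open>\<open>a \<le> c\<close> makes every Pochhammer ratio at most one, so the exponential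
  series dominates.\<close>

lemma kummer_M_sums:
  assumes "0 < a" "a \<le> c"
  shows "(\<lambda>k. pochhammer (complex_of_real a) k / pochhammer (of_real c) k * (z ^ k / fact k))
           sums kummer_M (of_real a) (of_real c) z"
proof -
  have bound: "norm (pochhammer (complex_of_real a) k / pochhammer (of_real c) k * (z ^ k / fact k))
          \<le> norm z ^ k / fact k" for k
  proof -
    have "pochhammer a k / pochhammer c k \<le> 1" "pochhammer a k > 0" "pochhammer c k > 0"
      using assms pochhammer_mono[of a c k] pochhammer_pos[of a k] pochhammer_pos[of c k]
      by (auto simp: divide_le_eq_1)
    moreover have "norm (pochhammer (complex_of_real a) k / pochhammer (of_real c) k * (z ^ k / fact k))
        = pochhammer a k / pochhammer c k * (norm z ^ k / fact k)"
      using calculation by (simp add: norm_mult norm_divide norm_power norm_of_real pochhammer_of_real)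
    ultimately show ?thesis
      by (simp only:) (intro mult_left_le_one_le, auto)
  qed
  have "summable (\<lambda>k. norm z ^ k / fact k)"
    using summable_exp_generic[of "norm z"] by (simp add: divide_inverse mult.commute)
  from summable_comparison_test'[OF this bound] show ?thesis
    unfolding kummer_M_def by (rule summable_sums)
qed

text \<open>Since (a)_(k+1) - (a-1)_(k+1) = (k + 1) (a)_k, the difference on the right loses its
  constant term and one factor of the factorial, which leaves z times the series on the
  left.\<close>

lemma kummer_M_contiguous:
  assumes "1 < a" "a + 1 < c"
  shows "z * kummer_M (of_real a) (of_real c) z =
    of_real (c - 1) * (kummer_M (of_real a) (of_real (c - 1)) z -
                       kummer_M (of_real (a - 1)) (of_real (c - 1)) (z::complex))"
    (is "?l = ?r")
proof -
  have 1: "(\<lambda>k. of_real (c - 1) *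
      (pochhammer (complex_of_real a) k / pochhammer (of_real (c-1)) k * (z ^ k / fact k) -
       pochhammer (complex_of_real (a-1)) k / pochhammer (of_real (c-1)) k * (z ^ k / fact k))) sums ?r"
    (is "?f sums _")
    by (intro sums_mult sums_diff kummer_M_sums) (use assms in auto)
  have "(\<lambda>k. z * (pochhammer (complex_of_real a) k / pochhammer (of_real c) k * (z ^ k / fact k))) sums ?l"
    by (intro sums_mult kummer_M_sums) (use assms in auto)
  moreover have "?f (Suc k) = z * (pochhammer (complex_of_real a) k / pochhammer (of_real c) k * (z ^ k / fact k))" for k
  proof -
    have p: "pochhammer (complex_of_real c) k \<noteq> 0" "complex_of_real c - 1 \<noteq> 0"
      using assms pochhammer_pos[of c k] by (auto simp: pochhammer_of_real)
    have "pochhammer (complex_of_real a) (Suc k) = pochhammer (of_real a) k * (of_real a + of_nat k)"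
      "pochhammer (complex_of_real (a - 1)) (Suc k) = (of_real a - 1) * pochhammer (of_real a) k"
      "pochhammer (complex_of_real (c - 1)) (Suc k) = (of_real c - 1) * pochhammer (of_real c) k"
      using pochhammer_rec[of "complex_of_real (a-1)" k] pochhammer_rec[of "complex_of_real (c-1)" k]
      by (simp_all add: pochhammer_Suc)
    moreover have "1 + of_nat k \<noteq> (0::complex)"
      using of_nat_neq_0[of k, where ?'a=complex] by simp
    ultimately show ?thesis using p
      by (simp add: divide_simps) (simp add: algebra_simps)
  qed
  ultimately have "(\<lambda>k. ?f (Suc k)) sums ?l" by simp
  then have "?f sums (?l + ?f 0)" by (rule sums_Suc_iff[THEN iffD1])
  then show ?thesis using sums_unique2[OF 1] by simp
qed

text \<open>Under the Beta integral this is 1 = t + (1 - t). On coefficients, a (a+1)_k = (a)_k (a +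
  k), so the two numerators add up to (a)_k (c + k). In the decay proof it raises one of two small
  exponents above 1.\<close>

lemma kummer_M_split:
  assumes "0 < a" "a < c"
  shows "kummer_M (of_real a) (of_real c) z =
    of_real (a / c) * kummer_M (of_real (a + 1)) (of_real (c + 1)) z +
    of_real ((c - a) / c) * kummer_M (of_real a) (of_real (c + 1)) (z::complex)"
    (is "_ = ?r")
proof -
  have 1: "(\<lambda>k. of_real (a / c) *
      (pochhammer (complex_of_real (a+1)) k / pochhammer (of_real (c+1)) k * (z ^ k / fact k)) +
       of_real ((c-a)/c) * (pochhammer (complex_of_real a) k / pochhammer (of_real (c+1)) k * (z ^ k / fact k))) sums ?r"
    (is "?f sums _")
    by (intro sums_mult sums_add kummer_M_sums) (use assms in auto)
  have "?f k = pochhammer (complex_of_real a) k / pochhammer (of_real c) k * (z ^ k / fact k)" for k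
  proof -
    have p: "pochhammer (complex_of_real (c+1)) k \<noteq> 0" "pochhammer (complex_of_real c) k \<noteq> 0"
       "complex_of_real c \<noteq> 0" "complex_of_real c + of_nat k \<noteq> 0"
    proof -
      have "pochhammer (c+1) k \<noteq> 0" "pochhammer c k \<noteq> 0" "c + real k \<noteq> 0" "c \<noteq> 0"
        using assms pochhammer_pos[of c k] pochhammer_pos[of "c+1" k] by auto
      then show "pochhammer (complex_of_real (c+1)) k \<noteq> 0" "pochhammer (complex_of_real c) k \<noteq> 0"
         "complex_of_real c \<noteq> 0" "complex_of_real c + of_nat k \<noteq> 0"
        by (metis of_real_add of_real_eq_0_iff of_real_of_nat_eq pochhammer_of_real)+
    qed
    have 2: "of_real a * pochhammer (complex_of_real (a+1)) k = pochhammer (of_real a) k * (of_real a + of_nat k)"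
       and 3: "of_real c * pochhammer (complex_of_real (c+1)) k = pochhammer (of_real c) k * (of_real c + of_nat k)"
      using pochhammer_rec[of "complex_of_real a" k] pochhammer_rec[of "complex_of_real c" k]
      by (simp_all add: pochhammer_Suc)
    have "?f k = (of_real a * pochhammer (complex_of_real (a+1)) k + (of_real c - of_real a) * pochhammer (of_real a) k)
           / (of_real c * pochhammer (complex_of_real (c+1)) k) * (z ^ k / fact k)"
      using p by (simp add: field_simps)
    also have "\<dots> = pochhammer (complex_of_real a) k * (of_real c + of_nat k)
           / (pochhammer (of_real c) k * (of_real c + of_nat k)) * (z ^ k / fact k)"
      unfolding 2 3 by (simp add: algebra_simps)
    finally show ?thesis using p by simp
  qed
  then have "?f sums kummer_M (of_real a) (of_real c) z"
    using kummer_M_sums[of a c z] assms by (simp only: less_imp_le)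
  then show ?thesis by (rule sums_unique2[OF _ 1])
qed

lemma gauss_F_sums:
  fixes A B C z :: real
  assumes "C > 0" "\<bar>z\<bar> < 1"
  shows "(\<lambda>k. pochhammer A k * pochhammer B k / pochhammer C k * (z ^ k / fact k))
           sums gauss_F A B C z"
proof -
  define f where "f = (\<lambda>k. pochhammer A k * pochhammer B k / pochhammer C k * (z ^ k / fact k))"
  define r where "r = (\<lambda>k. (A + real k) * (B + real k) / ((C + real k) * (1 + real k)) * z)"
  have fr: "f (Suc k) = r k * f k" for k
  proof -
    have "pochhammer C k > 0" using assms by (auto intro: pochhammer_pos)
    then show ?thesis using assms by (simp add: f_def r_def pochhammer_Suc divide_simps)
  qed
  have "((\<lambda>k. (A + real k) * (B + real k) / ((C + real k) * (1 + real k))) \<longlongrightarrow> 1) at_top"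
  proof -
    have *: "(\<lambda>k. (x + real k) / (y + real k)) \<longlonglongrightarrow> 1" if "y > 0" for x y :: real
    proof -
      have "(\<lambda>k. 1 + (x - y) / (y + real k)) \<longlonglongrightarrow> 1 + 0"
        by (intro tendsto_add tendsto_const tendsto_divide_0[OF tendsto_const]
              filterlim_at_top_imp_at_infinity filterlim_tendsto_add_at_top[OF tendsto_const]
              filterlim_real_sequentially)
      moreover have "1 + (x - y) / (y + real k) = (x + real k) / (y + real k)" for k
        using that by (simp add: field_simps)
      ultimately show ?thesis by simp
    qed
    show ?thesis
      using tendsto_mult[OF *[of C A] *[of 1 B]] assms by simp
  qed
  then have "r \<longlonglongrightarrow> 1 * z" unfolding r_def by (intro tendsto_mult tendsto_const)
  then have "(\<lambda>k. \<bar>r k\<bar>) \<longlonglongrightarrow> \<bar>z\<bar>" by (simp add: tendsto_rabs)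
  moreover obtain q where q: "\<bar>z\<bar> < q" "q < 1" using assms dense by blast
  ultimately have "eventually (\<lambda>k. \<bar>r k\<bar> < q) sequentially" by (simp add: order_tendstoD)
  then obtain N where N: "\<bar>r k\<bar> < q" if "k \<ge> N" for k
    by (auto simp: eventually_sequentially)
  have "norm (f (Suc k)) \<le> q * norm (f k)" if "k \<ge> N" for k
    using N[OF that] by (auto simp: fr abs_mult intro!: mult_right_mono)
  then have "summable f" using q by (intro summable_ratio_test[of q N]) auto
  then show ?thesis by (simp add: gauss_F_def f_def summable_sums)
qed

text \<open>Coefficients are compared after an index shift, using (B-1)_(k+1) - (B)_(k+1) = -(k + 1)
  (B)_k. This is the counterpart of \<open>kummer_M_contiguous\<close> for the branch y < 0.\<close>

lemma gauss_F_contiguous_1: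
  fixes A B C z :: real
  assumes "C > 1" "\<bar>z\<bar> < 1"
  shows "(C - 1) * (gauss_F A (B - 1) (C - 1) z - gauss_F A B (C - 1) z) = - (A * z * gauss_F (A + 1) B C z)"
  (is "?l = ?r")
proof -
  have 1: "(\<lambda>k. (C - 1) *
      (pochhammer A k * pochhammer (B-1) k / pochhammer (C-1) k * (z ^ k / fact k) -
       pochhammer A k * pochhammer B k / pochhammer (C-1) k * (z ^ k / fact k))) sums ?l"
    (is "?f sums _")
    by (intro sums_mult sums_diff gauss_F_sums) (use assms in auto)
  have "(\<lambda>k. - (A * z * (pochhammer (A+1) k * pochhammer B k / pochhammer C k * (z ^ k / fact k)))) sums ?r"
    by (intro sums_mult sums_minus gauss_F_sums) (use assms in auto)
  moreover have "?f (Suc k) = - (A * z * (pochhammer (A+1) k * pochhammer B k / pochhammer C k * (z ^ k / fact k)))" for k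
  proof -
    have p: "pochhammer C k \<noteq> 0" "C - 1 \<noteq> 0"
      using assms pochhammer_pos[of C k] by auto
    have "pochhammer A (Suc k) = A * pochhammer (A+1) k"
      "pochhammer B (Suc k) = pochhammer B k * (B + real k)"
      "pochhammer (B - 1) (Suc k) = (B - 1) * pochhammer B k"
      "pochhammer (C - 1) (Suc k) = (C - 1) * pochhammer C k"
      using pochhammer_rec[of "B-1" k] pochhammer_rec[of "C-1" k]
      by (simp_all only: pochhammer_rec[of A k] pochhammer_Suc[of B k] add.commute[of 1] diff_add_cancel)
    then show ?thesis using p
      by (simp add: divide_simps) (simp add: algebra_simps)
  qed
  ultimately have "(\<lambda>k. ?f (Suc k)) sums ?r" by simp
  then have "?f sums (?r + ?f 0)" by (rule sums_Suc_iff[THEN iffD1])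
  then show ?thesis using sums_unique2[OF 1] by simp
qed

text \<open>The difference of the series for A - 1 and A shifts by one index and leaves a factor (B
  + k) / (C + k); writing it as 1 - (C - B) / (C + k) produces the two series on the right. It
  serves the branch 0 < y < 1.\<close>

lemma gauss_F_contiguous_2:
  fixes A B C z :: real
  assumes "C > 0" "\<bar>z\<bar> < 1"
  shows "gauss_F (A - 1) B C z = (1 - z) * gauss_F A B C z + (C - B) / C * z * gauss_F A B (C + 1) z"
proof -
  define t where "t = (\<lambda>A B C k. pochhammer A k * pochhammer B k / pochhammer C k * (z ^ k / fact k))"
  have S: "t A B C sums gauss_F A B C z" if "C > 0" for A B C
    using gauss_F_sums[OF that] assms unfolding t_def by simp
  have 1: "(\<lambda>k. t (A-1) B C k - t A B C k) sums (gauss_F (A-1) B C z - gauss_F A B C z)"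
    (is "?f sums _")
    by (intro sums_diff S assms)
  have "(\<lambda>k. (C - B) / C * z * t A B (C+1) k - z * t A B C k) sums
           ((C - B) / C * z * gauss_F A B (C + 1) z - z * gauss_F A B C z)" (is "_ sums ?r")
    by (intro sums_mult sums_diff S) (use assms in auto)
  moreover have "?f (Suc k) = (C - B) / C * z * t A B (C+1) k - z * t A B C k" for k
  proof -
    have p: "pochhammer C k > 0" "pochhammer (C+1) k > 0"
      using assms by (auto intro!: pochhammer_pos)
    have c: "pochhammer C k * (C + real k) = C * pochhammer (C+1) k"
      using pochhammer_rec[of C k] by (simp add: pochhammer_Suc)
    have c': "pochhammer (C+1) k = pochhammer C k * (C + real k) / C"
      using c assms by (simp add: field_simps)
    have A: "pochhammer (A - 1) (Suc k) = (A - 1) * pochhammer A k"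
      using pochhammer_rec[of "A-1" k] by simp
    have "?f (Suc k) = (pochhammer A k * pochhammer B k * (B + real k) / (pochhammer C k * (C + real k)))
          * (z ^ Suc k / fact (Suc k)) * ((A - 1) - (A + real k))"
    proof -
      have "x * p * (q * s) / r * Z - p * y * (q * s) / r * Z = p * q * s / r * Z * (x - y)" for x y p q r s Z :: real
        by (simp add: algebra_simps diff_divide_distrib)
      then show ?thesis
        unfolding t_def A unfolding pochhammer_Suc by (simp only:)
    qed
    also have "\<dots> = (C - B) / C * z * t A B (C+1) k - z * t A B C k"
      unfolding t_def c' using p assms by (simp add: divide_simps) (simp add: algebra_simps)
    finally show ?thesis .
  qed
  ultimately have "(\<lambda>k. ?f (Suc k)) sums ?r" by simp
  then have "?f sums (?r + ?f 0)" by (rule sums_Suc_iff[THEN iffD1])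
  then show ?thesis using sums_unique2[OF 1] by (simp add: t_def algebra_simps)
qed

section \<open>Beta densities\<close>

text \<open>Unnormalised, with mass \<open>Beta p q\<close>, so that multiplication by t^k merely
  shifts \<open>p\<close>. The factors \<open>Beta p q\<close> in later identities are the missing
  normalisation.\<close>

definition beta_density :: "real \<Rightarrow> real \<Rightarrow> real \<Rightarrow> real" where
  "beta_density p q t = indicator {0<..<1} t * (t powr (p - 1) * (1 - t) powr (q - 1))"

lemma beta_density_nonneg [simp]: "beta_density p q t \<ge> 0"
  by (auto simp: beta_density_def)

lemma beta_density_eq_0: "t \<le> 0 \<or> t \<ge> 1 \<Longrightarrow> beta_density p q t = 0"
  by (auto simp: beta_density_def)

lemma borel_measurable_beta_density [measurable]: "beta_density p q \<in> borel_measurable borel"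
  unfolding beta_density_def by measurable

lemma beta_density_swap: "beta_density p q (1 - t) = beta_density q p t"
  by (auto simp: beta_density_def indicator_def)

lemma beta_density_power: "beta_density p q t * t ^ k = beta_density (p + real k) q t"
proof -
  have "t powr (p - 1) * t ^ k = t powr (p + real k - 1)" if "t > 0"
    using that by (simp flip: powr_realpow powr_add add: algebra_simps)
  then show ?thesis by (auto simp: beta_density_def indicator_def)
qed

text \<open>Carries gauge integrals over to Lebesgue integrals; nonnegativity makes the convergence
  absolute.\<close>

lemma has_bochner_integral_lborel_nonneg:
  fixes f :: "real \<Rightarrow> real"
  assumes "(f has_integral I) S" "\<And>x. x \<in> S \<Longrightarrow> f x \<ge> 0"
    and m: "(\<lambda>x. indicator S x * f x) \<in> borel_measurable borel"
  shows "has_bochner_integral lborel (\<lambda>x. indicator S x * f x) I"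
proof (rule has_bochner_integral_nn_integral)
  have "((\<lambda>x. indicator S x * f x) has_integral I) UNIV"
    using assms(1) by (subst (asm) has_integral_restrict_UNIV[symmetric])
      (simp add: indicator_def of_bool_def if_distrib[of "\<lambda>x. x * _"] cong: if_cong)
  moreover have "indicator S x * f x \<ge> 0" for x using assms(2) by (auto simp: indicator_def)
  ultimately show "(\<integral>\<^sup>+ x. ennreal (indicator S x * f x) \<partial>lborel) = ennreal I"
    using m by (intro nn_integral_has_integral_lborel) auto
  show "I \<ge> 0" using assms(1,2) by (rule has_integral_nonneg)
  show "AE x in lborel. 0 \<le> indicator S x * f x" using assms(2) by (auto simp: indicator_def)
qed (use m in simp)

lemma has_bochner_integral_beta_density:
  assumes "p > 0" "q > 0"
  shows "has_bochner_integral lborel (beta_density p q) (Beta p q)"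
proof -
  have "((\<lambda>t. t powr (p - 1) * (1 - t) powr (q - 1)) has_integral Beta p q) {0<..<1}"
    using has_integral_Beta_real[OF assms] by (simp add: has_integral_Icc_iff_Ioo)
  from has_bochner_integral_lborel_nonneg[OF this] show ?thesis
    by (simp add: beta_density_def[abs_def])
qed

lemma integrable_beta_density:
  "p > 0 \<Longrightarrow> q > 0 \<Longrightarrow> integrable lborel (beta_density p q)"
  using has_bochner_integral_beta_density by (auto simp: has_bochner_integral_iff)

lemma integrable_beta_density_bounded:
  fixes g :: "real \<Rightarrow> complex"
  assumes "p > 0" "q > 0" "g \<in> borel_measurable borel" "\<And>t. 0 < t \<Longrightarrow> t < 1 \<Longrightarrow> norm (g t) \<le> C"
  shows "integrable lborel (\<lambda>t. beta_density p q t * g t)"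
proof (rule Bochner_Integration.integrable_bound)
  show "integrable lborel (\<lambda>t. C * beta_density p q t)"
    using integrable_beta_density[OF assms(1,2)] by simp
  show "AE t in lborel. norm (complex_of_real (beta_density p q t) * g t) \<le> norm (C * beta_density p q t)"
  proof (rule AE_I2)
    fix t
    show "norm (complex_of_real (beta_density p q t) * g t) \<le> norm (C * beta_density p q t)"
    proof (cases "0 < t \<and> t < 1")
      case True
      then have "norm (g t) \<le> \<bar>C\<bar>" using assms(4)[of t] by linarith
      from mult_right_mono[OF this, of "beta_density p q t"] show ?thesis
        by (simp add: norm_mult abs_mult mult.commute)
    next
      case False
      then show ?thesis by (auto simp: beta_density_eq_0 not_less)
    qed
  qed
qed (use assms(3) in measurable)

text \<open>Term-by-term integration of the exponential series: the k-th moment is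
  \<open>Beta (p + real k) q\<close>, which is at most \<open>Beta p q\<close>, so the exponential
  series again dominates.\<close>

lemma kummer_M_integral:
  assumes "p > 0" "q > 0"
  shows "of_real (Beta p q) * kummer_M (of_real p) (of_real (p + q)) (z::complex) =
           (LINT t|lborel. complex_of_real (beta_density p q t) * exp (z * complex_of_real t))"
proof -
  define f where "f = (\<lambda>k t. complex_of_real (beta_density p q t) * ((z * of_real t) ^ k /\<^sub>R fact k))"
  have fk: "f k t = of_real (beta_density (p + real k) q t) * (z ^ k / fact k)" for k t
    unfolding f_def beta_density_power[symmetric]
    by (simp add: power_mult_distrib scaleR_conv_of_real divide_inverse algebra_simps)
  have hb: "has_bochner_integral lborel (f k) (of_real (Beta (p + real k) q) * (z ^ k / fact k))" for k
    unfolding fk[abs_def]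
    by (intro has_bochner_integral_mult_left has_bochner_integral_of_real has_bochner_integral_beta_density)
       (use assms in auto)
  have S: "(\<lambda>k. f k t) sums (complex_of_real (beta_density p q t) * exp (z * complex_of_real t))" for t
    unfolding f_def by (intro sums_mult exp_converges)
  have int: "integrable lborel (f k)" for k using hb has_bochner_integral_iff by blast
  have "(\<lambda>k. integral\<^sup>L lborel (f k)) sums (\<integral>t. (\<Sum>k. f k t) \<partial>lborel)"
  proof (rule sums_integral[OF int])
    have "summable (\<lambda>k. norm (f k t))" for t
      unfolding f_def norm_mult by (intro summable_mult summable_norm_exp)
    then show "AE t in lborel. summable (\<lambda>k. norm (f k t))" by simp
    have N: "norm (f k t) = beta_density (p + real k) q t * (norm z ^ k / fact k)" for k t
      by (simp add: fk norm_mult norm_divide norm_power)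
    have "(LINT t|lborel. norm (f k t)) = Beta (p + real k) q * (norm z ^ k / fact k)" for k
      unfolding N using has_bochner_integral_beta_density[of "p + real k" q] assms
      by (simp add: has_bochner_integral_iff)
    moreover have "summable (\<lambda>k. Beta (p + real k) q * (norm z ^ k / fact k))"
    proof (rule summable_comparison_test'[of _ 0])
      show "summable (\<lambda>k. Beta p q * (norm z ^ k / fact k))"
        using summable_exp_generic[of "norm z"]
        by (intro summable_mult) (simp add: divide_inverse mult.commute)
      fix k :: nat
      have "Beta (p + real k) q \<le> Beta p q" using assms by (intro Beta_real_mono) auto
      moreover have "Beta (p + real k) q \<ge> 0" using assms by (auto simp: Beta_def)
      ultimately show "norm (Beta (p + real k) q * (norm z ^ k / fact k)) \<le> Beta p q * (norm z ^ k / fact k)"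
        using mult_right_mono[of "Beta (p + real k) q" "Beta p q" "norm z ^ k / fact k"]
        by (simp add: abs_mult)
    qed
    ultimately show "summable (\<lambda>k. LINT t|lborel. norm (f k t))" by simp
  qed
  moreover have "(\<Sum>k. f k t) = complex_of_real (beta_density p q t) * exp (z * complex_of_real t)" for t
    using S sums_unique by metis
  moreover have "integral\<^sup>L lborel (f k) = of_real (Beta (p + real k) q) * (z ^ k / fact k)" for k
    using hb has_bochner_integral_iff by blast
  moreover have "of_real (Beta (p + real k) q) = of_real (Beta p q) * (pochhammer (complex_of_real p) k / pochhammer (of_real (p + q)) k)" for k
    using Beta_add_of_nat_left[OF assms, of k] by (simp add: pochhammer_of_real flip: of_real_add)
  ultimately have 1: "(\<lambda>k. of_real (Beta p q) * (pochhammer (complex_of_real p) k / pochhammer (of_real (p + q)) k * (z ^ k / fact k)))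
      sums (LINT t|lborel. complex_of_real (beta_density p q t) * exp (z * complex_of_real t))"
    by (simp only: mult.assoc)
  show ?thesis
    by (rule sums_unique2[OF _ 1], intro sums_mult kummer_M_sums) (use assms in auto)
qed

text \<open>The reflection of t to 1 - t exchanges \<open>p\<close> and \<open>q\<close>. For
  imaginary z the factor exp z has modulus one, so decay estimates pass between the two
  orders.\<close>

lemma kummer_M_kummer_transformation:
  assumes "p > 0" "q > 0"
  shows "kummer_M (of_real p) (of_real (p + q)) z = exp z * kummer_M (of_real q) (of_real (p + q)) (- z :: complex)"
proof -
  have "(LINT t|lborel. complex_of_real (beta_density p q t) * exp (z * complex_of_real t)) =
        (LINT t|lborel. complex_of_real (beta_density q p t) * exp (z * of_real (1 - t)))"
    by (subst lborel_integral_real_affine[of "-1" _ 1]) (simp_all add: beta_density_swap)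
  also have "\<dots> = (LINT t|lborel. exp z * (complex_of_real (beta_density q p t) * exp (- z * complex_of_real t)))"
    by (intro Bochner_Integration.integral_cong) (auto simp: algebra_simps exp_diff exp_minus divide_inverse)
  also have "\<dots> = exp z * (LINT t|lborel. complex_of_real (beta_density q p t) * exp (- z * complex_of_real t))"
    by simp
  finally have "of_real (Beta p q) * kummer_M (of_real p) (of_real (p + q)) z =
     of_real (Beta p q) * (exp z * kummer_M (of_real q) (of_real (p + q)) (- z))"
    using kummer_M_integral[OF assms, of z] kummer_M_integral[OF assms(2,1), of "-z"]
    by (simp add: Beta_commute[of q p] add.commute[of q p])
  moreover have "Beta p q > 0" using assms by (auto simp: Beta_def)
  ultimately show ?thesis by simp
qed

section \<open>Decay on the imaginary axis\<close>

lemma kummer_M_decay_decreasing: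
  assumes "0 < p" "p \<le> 1" "1 \<le> q" "\<omega> \<noteq> 0"
  shows "Beta p q * norm (kummer_M (of_real p) (of_real (p + q)) (\<i> * of_real \<omega>)) \<le> (pi / \<bar>\<omega>\<bar>) powr p / p"
proof -
  \<comment> \<open>Shifting by half a period \<open>h\<close> flips the sign of the exponential, so twice the integral is bounded
    by the \<open>L\<^sup>1\<close> distance of the density from its shift, which telescopes by monotonicity.\<close>
  define h where "h = pi / \<bar>\<omega>\<bar>"
  define f where "f = beta_density p q"
  have h: "h > 0" using assms by (simp add: h_def)
  have int: "integrable lborel f" unfolding f_def using assms by (intro integrable_beta_density) auto
  have int_h: "integrable lborel (\<lambda>t. f (h + t))"
    using lborel_integrable_real_affine[OF int, of 1 h] by simp
  define E where "E = (\<lambda>t. exp (\<i> * of_real \<omega> * of_real t))"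
  have E [measurable]: "E \<in> borel_measurable borel" unfolding E_def by measurable
  have nE: "norm (E t) = 1" for t by (simp add: E_def)
  have intE: "integrable lborel (\<lambda>t. f t * E t)"
    unfolding f_def by (rule integrable_beta_density_bounded[where C=1]) (use assms nE in auto)
  have intEh: "integrable lborel (\<lambda>t. f (h + t) * E (h + t))"
    using lborel_integrable_real_affine[OF intE, of 1 h] by simp
  define J where "J = (LINT t|lborel. f t * E t)"
  have "\<omega> * h = pi \<or> \<omega> * h = - pi"
    using assms by (cases "\<omega> > 0") (auto simp: h_def)
  then have "exp (\<i> * complex_of_real (\<omega> * h)) = -1" by (auto simp: exp_minus simp del: of_real_mult)
  then have "exp (\<i> * of_real \<omega> * of_real h) = -1" by (simp add: mult.assoc)
  then have Eh: "E (h + t) = - E t" for t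
    by (simp add: E_def distrib_left exp_add)
  have "J = (LINT t|lborel. f (h + t) * E (h + t))"
    unfolding J_def by (subst lborel_integral_real_affine[of 1 _ h]) simp_all
  then have "2 * J = (LINT t|lborel. f t * E t + f (h + t) * E (h + t))"
    using intE intEh by (simp add: J_def)
  also have "\<dots> = (LINT t|lborel. (f t - f (h + t)) * E t)"
    by (simp add: Eh left_diff_distrib)
  finally have "2 * norm J = norm (LINT t|lborel. (f t - f (h + t)) * E t)"
    by (metis norm_mult norm_numeral)
  also have "\<dots> \<le> (LINT t|lborel. norm ((f t - f (h + t)) * E t))"
    by (rule integral_norm_bound)
  \<comment> \<open>For t > 0 the difference is nonnegative. For t \<le> 0 only the shifted term
    survives, with the opposite sign, and the indicator term corrects it. After integration f and
    its shift cancel, leaving twice the mass of f up to h.\<close>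
  also have "\<dots> = (LINT t|lborel. (f t - f (h + t)) + 2 * (indicator {..h} (h + t) * f (h + t)))"
  proof (rule Bochner_Integration.integral_cong)
    fix t :: real
    have "f (h + t) \<le> f t" if "t > 0"
    proof (cases "h + t < 1")
      case True
      have "(h + t) powr (p - 1) \<le> t powr (p - 1)"
        using that h assms by (intro powr_mono2') auto
      moreover have "(1 - (h + t)) powr (q - 1) \<le> (1 - t) powr (q - 1)"
        using that h assms True by (intro powr_mono2) auto
      ultimately have "(h + t) powr (p - 1) * (1 - (h + t)) powr (q - 1) \<le> t powr (p - 1) * (1 - t) powr (q - 1)"
        by (intro mult_mono) auto
      then show ?thesis using that h True unfolding f_def beta_density_def by simp
    next
      case False
      then show ?thesis by (simp add: f_def beta_density_eq_0)
    qed
    moreover have "f t = 0" if "t \<le> 0" using that by (simp add: f_def beta_density_eq_0)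
    moreover have "f (h + t) \<ge> 0" by (simp add: f_def)
    moreover have "norm ((f t - f (h + t)) * E t) = \<bar>f t - f (h + t)\<bar>"
      by (simp add: norm_mult nE flip: of_real_diff)
    ultimately show "norm ((f t - f (h + t)) * E t) = (f t - f (h + t)) + 2 * (indicator {..h} (h + t) * f (h + t))"
      by (auto simp: indicator_def)
  qed simp
  also have "\<dots> = 2 * (LINT t|lborel. indicator {..h} t * f t)"
  proof -
    have i: "integrable lborel (\<lambda>t. indicator {..h} t * f t)"
      using integrable_mult_indicator[OF _ int, of "{..h}"] by simp
    have "integrable lborel (\<lambda>t. indicator {..h} (h + t) * f (h + t))"
      using lborel_integrable_real_affine[OF i, of 1 h] by simp
    moreover have "(LINT t|lborel. indicator {..h} t * f t) = (LINT t|lborel. indicator {..h} (h + t) * f (h + t))"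
      by (subst lborel_integral_real_affine[of 1 _ h]) simp_all
    moreover have "(LINT t|lborel. f t) = (LINT t|lborel. f (h + t))"
      by (subst lborel_integral_real_affine[of 1 _ h]) simp_all
    ultimately show ?thesis using int int_h by simp
  qed
  \<comment> \<open>As q \<ge> 1, the factor (1 - t)^(q - 1) is at most one.\<close>
  also have "(LINT t|lborel. indicator {..h} t * f t) \<le> h powr p / p"
  proof -
    have "((\<lambda>t. t powr (p - 1)) has_integral h powr p / p) {0..h}"
      using has_integral_powr_from_0[of "p - 1" h] assms h by simp
    from has_bochner_integral_lborel_nonneg[OF this]
    have hb: "has_bochner_integral lborel (\<lambda>t. indicator {0..h} t * t powr (p - 1)) (h powr p / p)"
      by simp
    have "(LINT t|lborel. indicator {..h} t * f t) \<le> (LINT t|lborel. indicator {0..h} t * t powr (p - 1))"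
    proof (rule integral_mono)
      show "integrable lborel (\<lambda>t. indicator {..h} t * f t)"
        using integrable_mult_indicator[OF _ int, of "{..h}"] by simp
      show "integrable lborel (\<lambda>t. indicator {0..h} t * t powr (p - 1))"
        using hb has_bochner_integral_iff by blast
      fix t :: real
      have "t powr (p - 1) * (1 - t) powr (q - 1) \<le> t powr (p - 1)" if "0 < t" "t < 1"
        using that assms by (intro mult_left_le powr_le1) auto
      then show "indicator {..h} t * f t \<le> indicator {0..h} t * t powr (p - 1)"
        by (auto simp: f_def beta_density_def indicator_def)
    qed
    then show ?thesis using hb has_bochner_integral_iff by (metis (no_types, lifting))
  qed
  finally have "norm J \<le> h powr p / p" by simp
  moreover have "of_real (Beta p q) * kummer_M (of_real p) (of_real (p + q)) (\<i> * of_real \<omega>) = J"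
    unfolding J_def f_def E_def using kummer_M_integral assms by simp
  moreover have "Beta p q \<ge> 0" using assms by (auto simp: Beta_def)
  ultimately show ?thesis unfolding h_def
    by (metis abs_of_nonneg norm_mult norm_of_real)
qed

text \<open>If one exponent is at most 1 and the other at least 1, the density is monotone up to
  reflection and the half-period argument applies. Two exponents below 1 are reduced to this by
  \<open>kummer_M_split\<close>. Two above 1 are lowered by \<open>kummer_M_contiguous\<close>,
  whose factor z supplies the extra power of |\<omega>|.\<close>

lemma kummer_M_decay:
  assumes "p > 0" "q > 0"
  shows "\<exists>K. \<forall>\<omega>. \<bar>\<omega>\<bar> \<ge> 1 \<longrightarrow>
           norm (kummer_M (of_real p) (of_real (p + q)) (\<i> * of_real \<omega>)) \<le> K * \<bar>\<omega>\<bar> powr - min p q"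
proof -
  \<comment> \<open>The rate \<open>r\<close> is kept separate from \<open>min p q\<close>, so that
    estimates of different strength can be weakened to a common rate and combined.\<close>
  define P where "P = (\<lambda>p q r. \<exists>K. \<forall>\<omega>. \<bar>\<omega>\<bar> \<ge> 1 \<longrightarrow>
           norm (kummer_M (of_real p) (of_real (p + q)) (\<i> * of_real \<omega>)) \<le> K * \<bar>\<omega>\<bar> powr - r)"
  have weaken: "P p q r" if P: "P p q r'" and le: "r \<le> r'" for p q r r'
  proof -
    obtain K where K: "\<And>\<omega>. \<bar>\<omega>\<bar> \<ge> 1 \<Longrightarrow>
           norm (kummer_M (of_real p) (of_real (p + q)) (\<i> * of_real \<omega>)) \<le> K * \<bar>\<omega>\<bar> powr - r'"
      using P unfolding P_def by blast
    have "K * \<bar>\<omega>\<bar> powr - r' \<le> \<bar>K\<bar> * \<bar>\<omega>\<bar> powr - r" if "\<bar>\<omega>\<bar> \<ge> 1" for \<omega>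
      using that le by (intro mult_mono powr_mono) auto
    then show ?thesis unfolding P_def using K by (intro exI[of _ "\<bar>K\<bar>"]) (meson order_trans)
  qed
  \<comment> \<open>\<open>s\<close> is the power of |\<omega>| that the relation gains: 0 for a
    convex combination, 1 when the left side carries a factor z.\<close>
  have combine: "P p q r"
    if P12: "P p1 q1 (r - s)" "P p2 q2 (r - s)"
      and eq: "\<And>\<omega>. \<bar>\<omega>\<bar> \<ge> 1 \<Longrightarrow> \<bar>\<omega>\<bar> powr s * norm (kummer_M (of_real p) (of_real (p + q)) (\<i> * of_real \<omega>)) \<le>
        C1 * norm (kummer_M (of_real p1) (of_real (p1 + q1)) (\<i> * of_real \<omega>)) +
        C2 * norm (kummer_M (of_real p2) (of_real (p2 + q2)) (\<i> * of_real \<omega>))"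
      and C: "C1 \<ge> 0" "C2 \<ge> 0"
    for p q r s p1 q1 p2 q2 C1 C2
  proof -
    obtain K1 where K1: "\<And>\<omega>. \<bar>\<omega>\<bar> \<ge> 1 \<Longrightarrow>
           norm (kummer_M (of_real p1) (of_real (p1 + q1)) (\<i> * of_real \<omega>)) \<le> K1 * \<bar>\<omega>\<bar> powr - (r - s)"
      using P12(1) unfolding P_def by blast
    obtain K2 where K2: "\<And>\<omega>. \<bar>\<omega>\<bar> \<ge> 1 \<Longrightarrow>
           norm (kummer_M (of_real p2) (of_real (p2 + q2)) (\<i> * of_real \<omega>)) \<le> K2 * \<bar>\<omega>\<bar> powr - (r - s)"
      using P12(2) unfolding P_def by blast
    show ?thesis unfolding P_def
    proof (intro exI allI impI)
      fix \<omega> :: real assume w: "\<bar>\<omega>\<bar> \<ge> 1"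
      define N where "N = norm (kummer_M (of_real p) (of_real (p + q)) (\<i> * of_real \<omega>))"
      have "\<bar>\<omega>\<bar> powr s * N \<le> C1 * (K1 * \<bar>\<omega>\<bar> powr - (r - s)) + C2 * (K2 * \<bar>\<omega>\<bar> powr - (r - s))"
        unfolding N_def using K1[OF w] K2[OF w] C by (intro order_trans[OF eq[OF w]] add_mono mult_left_mono)
      then have "\<bar>\<omega>\<bar> powr - s * (\<bar>\<omega>\<bar> powr s * N) \<le>
         \<bar>\<omega>\<bar> powr - s * (C1 * (K1 * \<bar>\<omega>\<bar> powr - (r - s)) + C2 * (K2 * \<bar>\<omega>\<bar> powr - (r - s)))"
        by (intro mult_left_mono) auto
      also have "\<dots> = (C1 * K1 + C2 * K2) * (\<bar>\<omega>\<bar> powr - s * \<bar>\<omega>\<bar> powr - (r - s))"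
        by (simp add: algebra_simps)
      also have "\<bar>\<omega>\<bar> powr - s * \<bar>\<omega>\<bar> powr - (r - s) = \<bar>\<omega>\<bar> powr - r"
        by (simp flip: powr_add)
      also have "\<bar>\<omega>\<bar> powr - s * (\<bar>\<omega>\<bar> powr s * N) = (\<bar>\<omega>\<bar> powr - s * \<bar>\<omega>\<bar> powr s) * N"
        by simp
      also have "\<bar>\<omega>\<bar> powr - s * \<bar>\<omega>\<bar> powr s = 1"
        using w by (simp flip: powr_add)
      finally show "N \<le> (C1 * K1 + C2 * K2) * \<bar>\<omega>\<bar> powr - r" by simp
    qed
  qed
  have base: "P p q p" if "0 < p" "p \<le> 1" "1 \<le> q" for p q
    unfolding P_def
  proof (intro exI allI impI)
    fix \<omega> :: real assume w: "\<bar>\<omega>\<bar> \<ge> 1"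
    have B: "Beta p q > 0" using that by (auto simp: Beta_def)
    have "Beta p q * norm (kummer_M (of_real p) (of_real (p + q)) (\<i> * of_real \<omega>)) \<le> (pi / \<bar>\<omega>\<bar>) powr p / p"
      using that w by (intro kummer_M_decay_decreasing) auto
    also have "\<dots> = pi powr p / p * \<bar>\<omega>\<bar> powr - p"
      by (simp add: powr_divide powr_minus) (simp add: divide_inverse)
    finally show "norm (kummer_M (of_real p) (of_real (p + q)) (\<i> * of_real \<omega>)) \<le> (pi powr p / p / Beta p q) * \<bar>\<omega>\<bar> powr - p"
      using B that by (simp add: divide_simps mult_ac)
  qed
  have swap: "P p q r" if P: "P q p r" and pq: "p > 0" "q > 0" for p q r
  proof -
    obtain K where K: "\<And>\<omega>. \<bar>\<omega>\<bar> \<ge> 1 \<Longrightarrow>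
           norm (kummer_M (of_real q) (of_real (q + p)) (\<i> * of_real \<omega>)) \<le> K * \<bar>\<omega>\<bar> powr - r"
      using P unfolding P_def by blast
    show ?thesis unfolding P_def
    proof (intro exI allI impI)
      fix \<omega> :: real assume w: "\<bar>\<omega>\<bar> \<ge> 1"
      show "norm (kummer_M (of_real p) (of_real (p + q)) (\<i> * of_real \<omega>)) \<le> K * \<bar>\<omega>\<bar> powr - r"
        using K[of "-\<omega>"] w
        by (subst kummer_M_kummer_transformation[OF pq]) (simp add: norm_mult add.commute)
    qed
  qed
  \<comment> \<open>\<open>n\<close> bounds p + q. Only the case p, q > 1 uses the induction
    hypothesis, and there the sum drops by one.\<close>
  have "P p q (min p q)" if "p > 0" "q > 0" "p + q \<le> real n" for n p q
    using that
  proof (induction n arbitrary: p q)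
    case 0
    then show ?case by simp
  next
    case (Suc n)
    note pq = \<open>p > 0\<close> \<open>q > 0\<close>
    consider "p \<le> 1" "q \<ge> 1" | "q \<le> 1" "p \<ge> 1" | "p < 1" "q < 1" | "p > 1" "q > 1" by linarith
    then show ?case
    proof cases
      case 1
      then show ?thesis using base[of p q] pq by simp
    next
      case 2
      then show ?thesis using swap[OF base] pq by simp
    next
      case 3
      show ?thesis
      proof (rule combine[of "p + 1" q _ 0 p "q + 1"])
        show "P (p + 1) q (min p q - 0)"
          by (rule weaken[OF swap[OF base]]) (use 3 pq in auto)
        show "P p (q + 1) (min p q - 0)"
          by (rule weaken[OF base]) (use 3 pq in auto)
        show "p / (p + q) \<ge> 0" "q / (p + q) \<ge> 0" using pq by auto
        fix \<omega> :: real assume w: "\<bar>\<omega>\<bar> \<ge> 1"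
        show "\<bar>\<omega>\<bar> powr 0 * norm (kummer_M (of_real p) (of_real (p + q)) (\<i> * of_real \<omega>)) \<le>
          p / (p + q) * norm (kummer_M (of_real (p + 1)) (of_real (p + 1 + q)) (\<i> * of_real \<omega>)) +
          q / (p + q) * norm (kummer_M (of_real p) (of_real (p + (q + 1))) (\<i> * of_real \<omega>))"
        proof -
          define m1 where "m1 = kummer_M (of_real (p + 1)) (of_real (p + 1 + q)) (\<i> * of_real \<omega>)"
          define m2 where "m2 = kummer_M (of_real p) (of_real (p + (q + 1))) (\<i> * of_real \<omega>)"
          have "kummer_M (of_real p) (of_real (p + q)) (\<i> * of_real \<omega>) =
              of_real (p / (p + q)) * m1 + of_real (q / (p + q)) * m2"
            using kummer_M_split[of p "p + q" "\<i> * of_real \<omega>"] pq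
            by (simp add: m1_def m2_def add_ac)
          then have "norm (kummer_M (of_real p) (of_real (p + q)) (\<i> * of_real \<omega>)) \<le>
              norm (of_real (p / (p + q)) * m1) + norm (of_real (q / (p + q)) * m2)"
            by (simp only: norm_triangle_ineq)
          moreover have "\<bar>\<omega>\<bar> powr 0 = 1" using w by auto
          ultimately show ?thesis using pq
            unfolding m1_def[symmetric] m2_def[symmetric] norm_mult norm_of_real by simp
        qed
      qed
    next
      case 4
      show ?thesis
      \<comment> \<open>The minimum of the exponents drops by at most one in either neighbour;
        \<open>s\<close> = 1 makes up for the loss.\<close>
      proof (rule combine[of p "q - 1" _ 1 "p - 1" q])
        show "P p (q - 1) (min p q - 1)"
          by (rule weaken[OF Suc.IH]) (use 4 Suc.prems in auto)
        show "P (p - 1) q (min p q - 1)"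
          by (rule weaken[OF Suc.IH]) (use 4 Suc.prems in auto)
        show "p + q - 1 \<ge> 0" "p + q - 1 \<ge> 0" using 4 by auto
        fix \<omega> :: real assume w: "\<bar>\<omega>\<bar> \<ge> 1"
        define m1 where "m1 = kummer_M (of_real p) (of_real (p + (q - 1))) (\<i> * of_real \<omega>)"
        define m2 where "m2 = kummer_M (of_real (p - 1)) (of_real (p - 1 + q)) (\<i> * of_real \<omega>)"
        have "\<i> * of_real \<omega> * kummer_M (of_real p) (of_real (p + q)) (\<i> * of_real \<omega>) = of_real (p + q - 1) * (m1 - m2)"
          using kummer_M_contiguous[of p "p + q" "\<i> * of_real \<omega>"] 4
          by (simp add: m1_def m2_def algebra_simps)
        from arg_cong[OF this, of norm]
        have "\<bar>\<omega>\<bar> * norm (kummer_M (of_real p) (of_real (p + q)) (\<i> * of_real \<omega>)) = (p + q - 1) * norm (m1 - m2)"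
          using 4 unfolding norm_mult norm_of_real by simp
        also have "\<dots> \<le> (p + q - 1) * (norm m1 + norm m2)"
          using 4 by (intro mult_left_mono norm_triangle_ineq4) auto
        finally show "\<bar>\<omega>\<bar> powr 1 * norm (kummer_M (of_real p) (of_real (p + q)) (\<i> * of_real \<omega>)) \<le>
          (p + q - 1) * norm (kummer_M (of_real p) (of_real (p + (q - 1))) (\<i> * of_real \<omega>)) +
          (p + q - 1) * norm (kummer_M (of_real (p - 1)) (of_real (p - 1 + q)) (\<i> * of_real \<omega>))"
          using w by (simp add: m1_def m2_def distrib_left)
      qed
    qed
  qed
  from this[OF assms real_nat_ceiling_ge] show ?thesis unfolding P_def .
qed

section \<open>The symbol\<close>

text \<open>Splitting off the positive factor |\<omega>| is harmless for the principal branch, and i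
  sgn(\<omega>) has argument sgn(\<omega>) pi / 2. At \<omega> = 0 both sides vanish, because
  \<open>0 powr r\<close> is 0.\<close>

lemma imaginary_powr_of_real:
  "(\<i> * of_real \<omega>) powr of_real r = of_real (\<bar>\<omega>\<bar> powr r) * exp (\<i> * of_real (pi / 2 * r * sgn \<omega>))"
proof (cases "\<omega> = 0")
  case False
  have "\<i> * complex_of_real \<omega> = of_real \<bar>\<omega>\<bar> * (\<i> * of_real (sgn \<omega>))"
    by (auto simp: sgn_if abs_if)
  then have "(\<i> * of_real \<omega>) powr of_real r = complex_of_real \<bar>\<omega>\<bar> powr of_real r * (\<i> * of_real (sgn \<omega>)) powr of_real r"
    by (simp only:) (rule powr_times_real_left, auto)
  also have "complex_of_real \<bar>\<omega>\<bar> powr of_real r = of_real (\<bar>\<omega>\<bar> powr r)"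
    by (simp add: powr_of_real)
  also have "(\<i> * of_real (sgn \<omega>)) powr of_real r = exp (\<i> * of_real (pi / 2 * r * sgn \<omega>))"
    using False by (cases "\<omega> > 0") (auto simp: powr_def sgn_if algebra_simps)
  finally show ?thesis .
qed simp

lemma borel_measurable_kummer_M [measurable]:
  "(\<lambda>\<omega>. kummer_M a c (\<i> * complex_of_real \<omega>)) \<in> borel_measurable borel"
  unfolding kummer_M_def by measurable

lemma borel_measurable_kummer_symbol [measurable]:
  "kummer_symbol a b c \<in> borel_measurable borel"
  unfolding kummer_symbol_def[abs_def] imaginary_powr_of_real by measurable

text \<open>M averages the unimodular exp(i\<omega>t) against a probability density. This controls
  the symbol near \<omega> = 0, where the decay estimate is silent.\<close>

lemma norm_kummer_M_le_1:
  assumes "p > 0" "q > 0"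
  shows "norm (kummer_M (of_real p) (of_real (p + q)) (\<i> * of_real \<omega>)) \<le> 1"
proof -
  have B: "Beta p q > 0" using assms by (auto simp: Beta_def)
  have "Beta p q * norm (kummer_M (of_real p) (of_real (p + q)) (\<i> * of_real \<omega>)) =
     norm (of_real (Beta p q) * kummer_M (of_real p) (of_real (p + q)) (\<i> * of_real \<omega>))"
    using B unfolding norm_mult norm_of_real by simp
  also have "\<dots> \<le> (LINT t|lborel. norm (complex_of_real (beta_density p q t) * exp (\<i> * of_real \<omega> * of_real t)))"
    unfolding kummer_M_integral[OF assms] by (rule integral_norm_bound)
  also have "\<dots> = Beta p q"
    using has_bochner_integral_beta_density[OF assms]
    by (simp add: norm_mult has_bochner_integral_iff)
  finally show ?thesis using B by (simp add: mult_le_cancel_left1)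
qed

text \<open>Serves twice: as majorant of the symbol, and, translated to y, as majorant of the
  singularity |t - y|^(-b).\<close>

definition power_envelope :: "real \<Rightarrow> real \<Rightarrow> real \<Rightarrow> real" where
  "power_envelope r s x = (if \<bar>x\<bar> < 1 then \<bar>x\<bar> powr r else \<bar>x\<bar> powr s)"

lemma integrable_power_envelope:
  assumes "r > -1" "s < -1"
  shows "integrable lborel (power_envelope r s)"
proof -
  have 1: "has_bochner_integral lborel (\<lambda>x. indicator {0..1} x * x powr r) (1 powr (r + 1) / (r + 1))"
    by (rule has_bochner_integral_lborel_nonneg) (use assms has_integral_powr_from_0[of r 1] in auto)
  have 2: "has_bochner_integral lborel (\<lambda>x. indicator {1..} x * x powr s) (-(1 powr (s+1)) / (s+1))"
    by (rule has_bochner_integral_lborel_nonneg) (use assms has_integral_powr_to_inf[of s 1] in auto)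
  define g where "g = (\<lambda>x::real. indicator {0..1} x * x powr r + indicator {1..} x * x powr s)"
  have g: "integrable lborel g"
    unfolding g_def using 1 2 by (auto simp: has_bochner_integral_iff intro: Bochner_Integration.integrable_add)
  moreover have "integrable lborel (\<lambda>x. g (- x))"
    using lborel_integrable_real_affine[OF g, of "-1" 0] by simp
  ultimately have "integrable lborel (\<lambda>x. g x + g (- x))" by simp
  then show ?thesis
  proof (rule Bochner_Integration.integrable_bound)
    show "power_envelope r s \<in> borel_measurable lborel"
      unfolding power_envelope_def[abs_def] by measurable
    show "AE x in lborel. norm (power_envelope r s x) \<le> norm (g x + g (- x))"
      by (rule AE_I2) (auto simp: g_def power_envelope_def indicator_def)
  qed
qed

text \<open>\<open>K\<close> does not depend on \<open>b\<close>, which enters only through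
  |\<omega>|^(b - 1). This uniformity gives a single dominating function for the passage to b =
  1.\<close>

lemma kummer_symbol_bound:
  assumes "0 < a" "a < c"
  obtains K where "K \<ge> 0"
    "\<And>b \<omega>. norm (kummer_symbol a b c \<omega>) \<le> K * power_envelope (b - 1) (b - 1 - min a (c - a)) \<omega>"
proof -
  have pq: "a > 0" "c - a > 0" "a + (c - a) = c" using assms by auto
  obtain K where K: "\<And>\<omega>. \<bar>\<omega>\<bar> \<ge> 1 \<Longrightarrow>
      norm (kummer_M (of_real a) (of_real c) (\<i> * of_real \<omega>)) \<le> K * \<bar>\<omega>\<bar> powr - min a (c - a)"
    using kummer_M_decay[OF pq(1,2)] unfolding pq(3) by blast
  show ?thesis
  \<comment> \<open>The bound 1 covers |\<omega>| < 1, the decay constant covers the rest.\<close>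
  proof (rule that[of "max 1 K"])
    fix b \<omega> :: real
    define m where "m = kummer_M (of_real a) (of_real c) (\<i> * complex_of_real \<omega>)"
    have n: "norm (kummer_symbol a b c \<omega>) = \<bar>\<omega>\<bar> powr (b - 1) * norm m"
      by (simp add: kummer_symbol_def m_def norm_mult norm_powr_real_powr' del: of_real_diff)
    show "norm (kummer_symbol a b c \<omega>) \<le> max 1 K * power_envelope (b - 1) (b - 1 - min a (c - a)) \<omega>"
    proof (cases "\<bar>\<omega>\<bar> < 1")
      case True
      have "norm m \<le> max 1 K"
        using norm_kummer_M_le_1[OF pq(1,2), of \<omega>] unfolding pq(3) m_def by linarith
      then show ?thesis using True unfolding n power_envelope_def
        by (simp add: mult.commute mult_right_mono)
    next
      case False
      have "norm m \<le> max 1 K * \<bar>\<omega>\<bar> powr - min a (c - a)"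
        unfolding m_def by (rule order_trans[OF K]) (use False in \<open>auto intro!: mult_right_mono\<close>)
      then have "norm (kummer_symbol a b c \<omega>) \<le> \<bar>\<omega>\<bar> powr (b - 1) * (max 1 K * \<bar>\<omega>\<bar> powr - min a (c - a))"
        unfolding n by (intro mult_left_mono) auto
      also have "\<dots> = max 1 K * (\<bar>\<omega>\<bar> powr (b - 1) * \<bar>\<omega>\<bar> powr - min a (c - a))"
        by (simp add: mult_ac)
      also have "\<bar>\<omega>\<bar> powr (b - 1) * \<bar>\<omega>\<bar> powr - min a (c - a) = \<bar>\<omega>\<bar> powr (b - 1 - min a (c - a))"
        by (simp flip: powr_add)
      finally show ?thesis using False by (simp add: power_envelope_def)
    qed
  qed auto
qed

lemma norm_fourier_integrand: "norm (fourier_integrand g y \<omega>) = norm (g \<omega>)"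
  by (simp add: fourier_integrand_def norm_mult)

lemma borel_measurable_fourier_integrand [measurable]:
  "g \<in> borel_measurable borel \<Longrightarrow> fourier_integrand g y \<in> borel_measurable borel"
  unfolding fourier_integrand_def[abs_def]
  by (rule borel_measurable_times) (auto intro!: borel_measurable_continuous_onI continuous_intros)

text \<open>The hypotheses are exactly the integrability conditions of the envelope: b - 1 > -1 at
  the origin and b - 1 - min(a, c - a) < -1 at infinity.\<close>

lemma integrable_kummer_symbol:
  assumes "0 < b" "b < min a (c - a)"
  shows "integrable lborel (kummer_symbol a b c)"
proof -
  obtain K where K: "K \<ge> 0"
    "\<And>b \<omega>. norm (kummer_symbol a b c \<omega>) \<le> K * power_envelope (b - 1) (b - 1 - min a (c - a)) \<omega>"
    using kummer_symbol_bound[of a c] assms by auto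
  have "integrable lborel (\<lambda>\<omega>. K * power_envelope (b - 1) (b - 1 - min a (c - a)) \<omega>)"
    by (intro integrable_mult_right integrable_power_envelope) (use assms in auto)
  then show ?thesis
  proof (rule Bochner_Integration.integrable_bound)
    show "AE \<omega> in lborel. norm (kummer_symbol a b c \<omega>) \<le>
        norm (K * power_envelope (b - 1) (b - 1 - min a (c - a)) \<omega>)"
      by (intro AE_I2 order_trans[OF K(2)]) auto
  qed simp
qed

lemma integrable_fourier_integrand:
  assumes "integrable lborel g"
  shows "integrable lborel (fourier_integrand g y)"
  by (rule Bochner_Integration.integrable_bound[OF assms])
     (use assms in \<open>auto simp: norm_fourier_integrand\<close>)

section \<open>The Laplace transform of a power\<close>

lemma has_bochner_integral_Gamma_scaled:
  fixes b x :: real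
  assumes "b > 0" "x > 0"
  shows "has_bochner_integral lborel (\<lambda>u. indicator {0<..} u * (u powr (b - 1) * exp (- x * u))) (Gamma b * x powr - b)"
proof -
  have "has_bochner_integral lborel (\<lambda>t. indicator {0..} t * (t powr (b - 1) / exp t)) (Gamma b)"
    by (rule has_bochner_integral_lborel_nonneg) (use Gamma_integral_real assms in auto)
  then have "has_bochner_integral lborel (\<lambda>t. indicator {0..} (x * t) * ((x * t) powr (b - 1) / exp (x * t))) (Gamma b / x)"
    using assms by (subst (asm) lborel_has_bochner_integral_real_affine_iff[of x _ _ 0])
      (auto simp: divide_inverse mult_ac)
  then have "has_bochner_integral lborel (\<lambda>t. x powr (1 - b) *
       (indicator {0..} (x * t) * ((x * t) powr (b - 1) / exp (x * t)))) (x powr (1 - b) * (Gamma b / x))"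
    by (rule has_bochner_integral_mult_right)
  also have "(\<lambda>t. x powr (1 - b) * (indicator {0..} (x * t) * ((x * t) powr (b - 1) / exp (x * t)))) =
     (\<lambda>u. indicator {0<..} u * (u powr (b - 1) * exp (- x * u)))"
  proof
    fix t
    have "x powr (1 - b) * (x powr (b - 1) * t powr (b - 1)) = t powr (b - 1)"
      using assms by (simp flip: powr_add mult.assoc)
    then show "x powr (1 - b) * (indicator {0..} (x * t) * ((x * t) powr (b - 1) / exp (x * t))) =
      indicator {0<..} t * (t powr (b - 1) * exp (- x * t))"
      using assms by (auto simp: indicator_def powr_mult exp_minus divide_inverse zero_le_mult_iff mult.assoc[symmetric])
  qed
  also have "x powr (1 - b) * (Gamma b / x) = Gamma b * x powr - b"
    using assms by (simp add: powr_diff powr_minus divide_inverse)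
  finally show ?thesis .
qed

text \<open>The exponential is expanded around a real point \<open>x\<close> so far to the right that
  \<open>p\<close> lies in the disc of radius \<open>x\<close> about it.\<close>

lemma has_bochner_integral_Laplace_powr:
  fixes b :: real and p :: complex
  assumes b: "b > 0" and p: "Re p > 0"
  shows "has_bochner_integral lborel (\<lambda>u. of_real (indicator {0<..} u * u powr (b - 1)) * exp (- p * of_real u))
           (of_real (Gamma b) * p powr of_real (- b))"
proof -
  \<comment> \<open>The disc condition |x - p| < x amounts to x > |p|^2 / (2 Re p); the choice is
    twice this threshold.\<close>
  define x where "x = (norm p)\<^sup>2 / Re p"
  define d where "d = of_real x - p"
  have "p \<noteq> 0" using p by auto
  then have x: "x > 0" using p by (simp add: x_def)
  have "(norm d)\<^sup>2 < x\<^sup>2"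
  proof -
    have "(norm d)\<^sup>2 = x\<^sup>2 - 2 * x * Re p + (norm p)\<^sup>2"
      unfolding d_def cmod_power2 by (simp add: power2_eq_square algebra_simps)
    also have "2 * x * Re p = 2 * (norm p)\<^sup>2" using p by (simp add: x_def)
    finally show ?thesis using \<open>p \<noteq> 0\<close> by simp
  qed
  then have dx: "norm d < x" using x by (simp add: power2_less_imp_less)
  define g where "g = (\<lambda>k u. indicator {0<..} u * (u powr (b + real k - 1) * exp (- x * u)))"
  have hg: "has_bochner_integral lborel (g k) (Gamma (b + real k) * x powr - (b + real k))" for k
    unfolding g_def by (rule has_bochner_integral_Gamma_scaled) (use b x in auto)
  define f where "f = (\<lambda>k u. complex_of_real (g 0 u) * ((d * of_real u) ^ k /\<^sub>R fact k))"
  have fg: "f k u = of_real (g k u) * (d ^ k / fact k)" for k u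
  proof -
    have "g 0 u * u ^ k = g k u"
      by (auto simp: g_def indicator_def mult_ac simp flip: powr_realpow powr_add)
         (simp flip: powr_add mult.assoc add: algebra_simps)
    then have "complex_of_real (g k u) = of_real (g 0 u) * of_real u ^ k" by (metis of_real_mult of_real_power)
    then show ?thesis
      by (simp add: f_def power_mult_distrib scaleR_conv_of_real divide_inverse)
  qed
  have hf: "has_bochner_integral lborel (f k) (of_real (Gamma (b + real k) * x powr - (b + real k)) * (d ^ k / fact k))" for k
    unfolding fg[abs_def] by (intro has_bochner_integral_mult_left has_bochner_integral_of_real hg)
  have S: "(\<lambda>k. f k u) sums (of_real (g 0 u) * exp (d * of_real u))" for u
    unfolding f_def by (intro sums_mult exp_converges)
  have S': "(\<Sum>k. f k u) = of_real (indicator {0<..} u * u powr (b - 1)) * exp (- p * of_real u)" for u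
  proof -
    have "(\<Sum>k. f k u) = of_real (g 0 u) * exp (d * of_real u)" using S sums_unique by metis
    also have "\<dots> = of_real (indicator {0<..} u * u powr (b - 1)) * exp (- p * of_real u)"
    proof -
      have "exp (- p * of_real u) = of_real (exp (- x * u)) * exp (d * of_real u)"
        by (simp add: d_def algebra_simps flip: exp_add exp_of_real)
      then show ?thesis by (simp add: g_def mult_ac)
    qed
    finally show ?thesis .
  qed
  \<comment> \<open>Gamma(b + k) = Gamma(b) (b)_k turns the integrated series into the binomial
    series of (1 - d/x)^(-b) = (p/x)^(-b).\<close>
  have coeff: "Gamma (b + real k) * x powr - (b + real k) = Gamma b * x powr - b * (((- b) gchoose k) * fact k * (- 1) ^ k / x ^ k)" for k
  proof -
    have "b \<notin> \<int>\<^sub>\<le>\<^sub>0" using b by (auto elim!: nonpos_Ints_cases)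
    then have "Gamma (b + real k) = Gamma b * pochhammer b k"
      using Gamma_real_pos[OF b] by (simp add: pochhammer_Gamma)
    moreover have "(- 1) ^ k * (- 1) ^ k = (1::real)" by (simp flip: power_mult_distrib)
    moreover have "x powr - (b + real k) = x powr - b / x ^ k"
      using x by (simp add: powr_diff powr_minus powr_add powr_realpow divide_inverse)
    ultimately show ?thesis using x
      by (simp add: gbinomial_pochhammer field_simps)
  qed
  have int: "integrable lborel (f k)" for k using hf has_bochner_integral_iff by blast
  \<comment> \<open>Taking norms gives the same binomial series at the real point -|d|/x, inside its
    disc because |d| < x.\<close>
  have Sm: "summable (\<lambda>k. LINT u|lborel. norm (f k u))"
  proof -
    have "norm (f k u) = g k u * (norm d ^ k / fact k)" for k u
      by (simp add: fg norm_mult norm_divide norm_power) (simp add: g_def)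
    then have "(LINT u|lborel. norm (f k u)) = Gamma (b + real k) * x powr - (b + real k) * (norm d ^ k / fact k)" for k
      using hg[of k] by (simp add: has_bochner_integral_iff)
    also have "\<dots> k = Gamma b * x powr - b * (((- b) gchoose k) * (- (norm d / x)) ^ k)" for k
      unfolding coeff by (simp add: power_minus[of "norm d / x"] power_divide)
    finally have "(LINT u|lborel. norm (f k u)) = Gamma b * x powr - b * (((- b) gchoose k) * (- (norm d / x)) ^ k)" for k .
    moreover have "summable (\<lambda>k. Gamma b * x powr - b * (((- b) gchoose k) * (- (norm d / x)) ^ k))"
      by (intro summable_mult sums_summable[OF gen_binomial_real]) (use dx x in simp)
    ultimately show ?thesis by simp
  qed
  have An: "AE u in lborel. summable (\<lambda>k. norm (f k u))"
    unfolding f_def norm_mult by (intro AE_I2 summable_mult summable_norm_exp)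
  have "(\<lambda>k. integral\<^sup>L lborel (f k)) sums (\<integral>u. (\<Sum>k. f k u) \<partial>lborel)"
    by (rule sums_integral[OF int An Sm])
  moreover have "integral\<^sup>L lborel (f k) = of_real (Gamma b * x powr - b) * ((of_real (- b) gchoose k) * (- d / of_real x) ^ k)" for k
  proof -
    have "integral\<^sup>L lborel (f k) = of_real (Gamma (b + real k) * x powr - (b + real k)) * (d ^ k / fact k)"
      using hf has_bochner_integral_iff by blast
    also have "\<dots> = of_real (Gamma b * x powr - b) * ((of_real (- b) gchoose k) * (- d / of_real x) ^ k)"
      unfolding coeff by (simp add: power_minus[of "d / of_real x"] power_divide gbinomial_pochhammer pochhammer_of_real mult_ac)
    finally show ?thesis .
  qed
  moreover have "(\<lambda>k. of_real (Gamma b * x powr - b) * ((of_real (- b) gchoose k) * (- d / of_real x) ^ k))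
      sums (of_real (Gamma b * x powr - b) * (1 + - d / of_real x) powr of_real (- b))"
    by (intro sums_mult gen_binomial_complex) (use dx x in \<open>simp add: norm_divide\<close>)
  ultimately have "(\<integral>u. (\<Sum>k. f k u) \<partial>lborel) = of_real (Gamma b * x powr - b) * (1 + - d / of_real x) powr of_real (- b)"
    using sums_unique2 by (simp only:)
  also have "1 + - d / of_real x = p / of_real x"
    using x by (simp add: d_def field_simps)
  also have "of_real (Gamma b * x powr - b) * (p / of_real x) powr of_real (- b) = of_real (Gamma b) * p powr of_real (- b)"
  \<comment> \<open>The principal power is multiplicative when one factor is a positive real, here
    x.\<close>
  proof -
    have "p = of_real x * (p / of_real x)" using x by simp
    then have "p powr of_real (- b) = of_real x powr of_real (- b) * (p / of_real x) powr of_real (- b)"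
      using x powr_times_real_left[of "of_real x" "p / of_real x"] by (metis Reals_of_real Re_complex_of_real less_imp_le)
    then show ?thesis using x by (simp add: powr_of_real del: of_real_minus)
  qed
  finally show ?thesis
    using integrable_suminf[OF int An Sm] unfolding S' by (simp add: has_bochner_integral_iff)
qed

section \<open>The regularised kernel\<close>

text \<open>The integral of (i\<omega>)^(b - 1) exp(-\<epsilon>|\<omega>|) exp(i\<omega>s) over the
  line. The two summands are the Laplace transforms over the positive and the negative half-line,
  with the phases of (i\<omega>)^(b - 1) there.\<close>

definition power_kernel :: "real \<Rightarrow> real \<Rightarrow> real \<Rightarrow> complex" where
  "power_kernel b \<epsilon> s = of_real (Gamma b) *
     (exp (\<i> * of_real (pi / 2 * (b - 1))) * (of_real \<epsilon> - \<i> * of_real s) powr of_real (- b) +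
      exp (- (\<i> * of_real (pi / 2 * (b - 1)))) * (of_real \<epsilon> + \<i> * of_real s) powr of_real (- b))"

definition damped_power :: "real \<Rightarrow> real \<Rightarrow> real \<Rightarrow> complex" where
  "damped_power b \<epsilon> \<omega> = (\<i> * of_real \<omega>) powr of_real (b - 1) * of_real (exp (- \<epsilon> * \<bar>\<omega>\<bar>))"

lemma borel_measurable_damped_power [measurable]: "damped_power b \<epsilon> \<in> borel_measurable borel"
  unfolding damped_power_def[abs_def] imaginary_powr_of_real by measurable

text \<open>A positive \<open>\<epsilon>\<close> keeps both bases in the right half-plane, away from
  the branch cut, so the kernel is continuous.\<close>

lemma borel_measurable_power_kernel:
  assumes "\<epsilon> > 0"
  shows "power_kernel b \<epsilon> \<in> borel_measurable borel"
proof -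
  have *: "continuous_on UNIV (\<lambda>s. (of_real \<epsilon> + \<i> * complex_of_real (\<sigma> * s)) powr of_real (- b))" for \<sigma>
  proof (rule continuous_on_powr_complex)
    show "continuous_on UNIV (\<lambda>s. of_real \<epsilon> + \<i> * complex_of_real (\<sigma> * s))"
      by (intro continuous_intros)
  qed (use assms in \<open>auto simp: complex_eq_iff\<close>)
  have "continuous_on UNIV (power_kernel b \<epsilon>)"
    unfolding power_kernel_def[abs_def]
    using *[of 1] *[of "-1"]
    by (intro continuous_on_mult continuous_on_add continuous_on_const) simp_all
  then show ?thesis by (rule borel_measurable_continuous_onI)
qed

lemma has_bochner_integral_damped_power:
  assumes "b > 0" "\<epsilon> > 0"
  shows "has_bochner_integral lborel (\<lambda>\<omega>. damped_power b \<epsilon> \<omega> * exp (\<i> * of_real \<omega> * of_real s)) (power_kernel b \<epsilon> s)"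
proof -
  \<comment> \<open>\<open>\<sigma>\<close> = 1 describes the positive half-line and
    \<open>\<sigma>\<close> = -1 the negative one, reflected so that \<open>u\<close> is positive in
    both.\<close>
  define h where "h = (\<lambda>\<sigma> u. exp (\<i> * of_real (pi / 2 * (b - 1) * \<sigma>)) *
      (of_real (indicator {0<..} u * u powr (b - 1)) * exp (- (of_real \<epsilon> - \<i> * of_real (\<sigma> * s)) * complex_of_real u)))"
  have h: "has_bochner_integral lborel (h \<sigma>)
     (exp (\<i> * of_real (pi / 2 * (b - 1) * \<sigma>)) * (of_real (Gamma b) * (of_real \<epsilon> - \<i> * of_real (\<sigma> * s)) powr of_real (- b)))" for \<sigma>
    unfolding h_def by (intro has_bochner_integral_mult_right has_bochner_integral_Laplace_powr) (use assms in auto)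
  have "has_bochner_integral lborel (\<lambda>\<omega>. h (-1) (- \<omega>))
     (exp (\<i> * of_real (pi / 2 * (b - 1) * -1)) * (of_real (Gamma b) * (of_real \<epsilon> - \<i> * of_real (-1 * s)) powr of_real (- b)))"
    using h[of "-1"] by (subst (asm) lborel_has_bochner_integral_real_affine_iff[of "-1" _ _ 0]) simp_all
  from has_bochner_integral_add[OF h[of 1] this]
  have "has_bochner_integral lborel (\<lambda>\<omega>. h 1 \<omega> + h (-1) (- \<omega>)) (power_kernel b \<epsilon> s)"
    by (simp add: power_kernel_def distrib_left mult.left_commute)
  also have "(\<lambda>\<omega>. h 1 \<omega> + h (-1) (- \<omega>)) = (\<lambda>\<omega>. damped_power b \<epsilon> \<omega> * exp (\<i> * of_real \<omega> * of_real s))"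
  proof
    fix \<omega> :: real
    consider "\<omega> = 0" | "\<omega> > 0" | "\<omega> < 0" by linarith
    then show "h 1 \<omega> + h (-1) (- \<omega>) = damped_power b \<epsilon> \<omega> * exp (\<i> * of_real \<omega> * of_real s)"
    proof cases
      case 1
      then show ?thesis by (simp add: h_def damped_power_def)
    next
      case 2
      then show ?thesis
        unfolding h_def damped_power_def imaginary_powr_of_real
        by (simp add: algebra_simps flip: exp_add exp_of_real)
    next
      case 3
      then show ?thesis
        unfolding h_def damped_power_def imaginary_powr_of_real
        by (simp add: algebra_simps flip: exp_add exp_of_real)
    qed
  qed
  finally show ?thesis .
qed

lemma integrable_damped_power:
  assumes "b > 0" "\<epsilon> > 0"
  shows "integrable lborel (damped_power b \<epsilon>)"
  using has_bochner_integral_damped_power[OF assms, of 0] by (simp add: has_bochner_integral_iff)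

text \<open>Uniform in \<open>\<epsilon>\<close>, because |\<epsilon> + is| \<ge> |s|: this is the
  domination for the limit \<epsilon> = 0.\<close>

lemma norm_power_kernel_le:
  assumes "b > 0" "s \<noteq> 0"
  shows "norm (power_kernel b \<epsilon> s) \<le> 2 * Gamma b * \<bar>s\<bar> powr - b"
proof -
  have *: "norm ((of_real \<epsilon> + \<i> * of_real s) powr of_real (- b)) \<le> \<bar>s\<bar> powr - b" if "s \<noteq> 0" for s
  proof -
    have "\<bar>s\<bar> \<le> norm (of_real \<epsilon> + \<i> * of_real s)"
      using abs_Im_le_cmod[of "of_real \<epsilon> + \<i> * of_real s"] by simp
    then have "norm (of_real \<epsilon> + \<i> * of_real s) powr - b \<le> \<bar>s\<bar> powr - b"
      using assms that by (intro powr_mono2') auto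
    then show ?thesis by (simp add: norm_powr_real_powr' del: of_real_minus)
  qed
  have "norm (power_kernel b \<epsilon> s) \<le> Gamma b * (\<bar>s\<bar> powr - b + \<bar>s\<bar> powr - b)"
    unfolding power_kernel_def norm_mult norm_of_real
    using Gamma_real_pos[OF assms(1)] assms(2) *[of s] *[of "-s"]
    by (auto intro!: mult_mono order_trans[OF norm_triangle_ineq] add_mono simp: norm_mult simp del: of_real_minus)
       (simp_all)
  then show ?thesis by simp
qed

text \<open>In the limit the two summands are complex conjugates of phase pi/2 (b - 1) + pi/2 b
  sgn(s), so their sum is a cosine. For s < 0 the phase is -pi/2 and they cancel; for s > 0 the
  cosine is sin(pi b). As s is nonzero, the limiting bases stay off the cut.\<close>

lemma tendsto_power_kernel:
  assumes b: "0 < b" "b < 1" and s: "s \<noteq> 0" and e: "e \<longlonglongrightarrow> 0"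
  shows "(\<lambda>n. power_kernel b (e n) s) \<longlonglongrightarrow> of_real (2 * pi * rGamma (1 - b) * (indicator {0<..} s * s powr - b))"
proof -
  \<comment> \<open>The reflection formula, which brings in 1/Gamma(1 - b).\<close>
  have Ga: "Gamma b * sin (pi * b) = pi * rGamma (1 - b)"
  proof -
    have "complex_of_real (rGamma b * rGamma (1 - b)) = of_real (sin (pi * b) / pi)"
      using rGamma_reflection_complex[of "of_real b"]
      by (simp add: rGamma_complex_of_real[symmetric] flip: sin_of_real)
    then have "rGamma b * rGamma (1 - b) = sin (pi * b) / pi" by (simp only: of_real_eq_iff)
    moreover have "Gamma b > 0" using b by simp
    moreover have "rGamma b = 1 / Gamma b" by (simp add: rGamma_inverse_Gamma divide_inverse)
    ultimately show ?thesis by (simp add: field_simps)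
  qed
  have lim: "(\<lambda>n. (of_real (e n) + \<i> * of_real s) powr of_real (- b)) \<longlonglongrightarrow> (\<i> * of_real s) powr of_real (- b)"
    if "s \<noteq> 0" for s
  proof -
    have "(\<lambda>n. (of_real (e n) + \<i> * of_real s) powr of_real (- b)) \<longlonglongrightarrow> (of_real 0 + \<i> * of_real s) powr of_real (- b)"
      using that by (intro tendsto_powr_complex tendsto_intros e) (auto simp: complex_nonpos_Reals_iff)
    then show ?thesis by simp
  qed
  have "(\<lambda>n. power_kernel b (e n) s) \<longlonglongrightarrow> of_real (Gamma b) *
     (exp (\<i> * of_real (pi / 2 * (b - 1))) * (\<i> * of_real (- s)) powr of_real (- b) +
      exp (- (\<i> * of_real (pi / 2 * (b - 1)))) * (\<i> * of_real s) powr of_real (- b))"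
    unfolding power_kernel_def using lim[of s] lim[of "-s"] s
    by (intro tendsto_mult tendsto_add tendsto_const) simp_all
  also have "of_real (Gamma b) *
     (exp (\<i> * of_real (pi / 2 * (b - 1))) * (\<i> * of_real (- s)) powr of_real (- b) +
      exp (- (\<i> * of_real (pi / 2 * (b - 1)))) * (\<i> * of_real s) powr of_real (- b)) =
     of_real (Gamma b * \<bar>s\<bar> powr - b) *
      (exp (\<i> * of_real (pi / 2 * (b - 1) + pi / 2 * b * sgn s)) + exp (- (\<i> * of_real (pi / 2 * (b - 1) + pi / 2 * b * sgn s))))"
    unfolding imaginary_powr_of_real by (simp add: algebra_simps sgn_minus flip: exp_add)
  also have "exp (\<i> * of_real (pi / 2 * (b - 1) + pi / 2 * b * sgn s)) + exp (- (\<i> * of_real (pi / 2 * (b - 1) + pi / 2 * b * sgn s))) =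
     of_real (2 * cos (pi / 2 * (b - 1) + pi / 2 * b * sgn s))"
    by (simp add: cos_exp_eq flip: cos_of_real)
  also have "of_real (Gamma b * \<bar>s\<bar> powr - b) * of_real (2 * cos (pi / 2 * (b - 1) + pi / 2 * b * sgn s)) =
     complex_of_real (2 * pi * rGamma (1 - b) * (indicator {0<..} s * s powr - b))"
  proof (cases "s > 0")
    case True
    have "pi / 2 * (b - 1) + pi / 2 * b * sgn s = pi * b - pi / 2"
      using True by (simp add: field_simps)
    then have "cos (pi / 2 * (b - 1) + pi / 2 * b * sgn s) = cos (pi * b - pi / 2)"
      by (simp only:)
    also have "\<dots> = sin (pi * b)" by (simp add: cos_diff)
    finally have "Gamma b * \<bar>s\<bar> powr - b * (2 * cos (pi / 2 * (b - 1) + pi / 2 * b * sgn s)) = 2 * (Gamma b * sin (pi * b)) * s powr - b"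
      using True by simp
    then show ?thesis unfolding Ga using True by (simp flip: of_real_mult)
  next
    case False
    then have "pi / 2 * (b - 1) + pi / 2 * b * sgn s = - (pi / 2)"
      using s by (simp add: field_simps)
    then have "cos (pi / 2 * (b - 1) + pi / 2 * b * sgn s) = cos (- (pi / 2))"
      by (simp only:)
    then show ?thesis using False by simp
  qed
  finally show ?thesis .
qed

text \<open>With y away from 0 and 1 the singularities are separated: near y the density is bounded,
  elsewhere the power is.\<close>

lemma integrable_beta_density_powr_diff:
  assumes "p > 0" "q > 0" "0 < b" "b < 1" "y \<noteq> 0" "y \<noteq> 1"
  shows "integrable lborel (\<lambda>t. beta_density p q t * \<bar>t - y\<bar> powr - b)"
proof -
  \<comment> \<open>Half the distance from y to {0, 1}, so any t in (0, 1) with |t - y| < \<delta>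
    lies in [\<delta>, 1 - \<delta>].\<close>
  define \<delta> where "\<delta> = min \<bar>y\<bar> \<bar>1 - y\<bar> / 2"
  have \<delta>: "\<delta> > 0" using assms by (auto simp: \<delta>_def)
  \<comment> \<open>On [\<delta>, 1] a power x^r is at most 1 if r \<ge> 0 and at most \<delta>^r if
    r < 0; the sum covers both signs.\<close>
  define C where "C = (\<delta> powr (p - 1) + 1) * (\<delta> powr (q - 1) + 1)"
  have C: "C \<ge> 0" by (simp add: C_def)
  have env: "integrable lborel (power_envelope (- b) (- 2))"
    using assms by (intro integrable_power_envelope) auto
  then have env': "integrable lborel (\<lambda>t. power_envelope (- b) (- 2) (t - y))"
    using lborel_integrable_real_affine[OF env, of 1 "-y"] by simp
  have "integrable lborel (\<lambda>t. \<delta> powr - b * beta_density p q t + (C * power_envelope (- b) (- 2) (t - y) + \<delta> powr - b * beta_density p q t))"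
    by (intro Bochner_Integration.integrable_add integrable_mult_right env' integrable_beta_density assms)
  then show ?thesis
  proof (rule Bochner_Integration.integrable_bound)
    show "AE t in lborel. norm (beta_density p q t * \<bar>t - y\<bar> powr - b) \<le>
      norm (\<delta> powr - b * beta_density p q t + (C * power_envelope (- b) (- 2) (t - y) + \<delta> powr - b * beta_density p q t))"
    proof (rule AE_I2)
      fix t :: real
      have env0: "power_envelope (- b) (- 2) (t - y) \<ge> 0" by (simp add: power_envelope_def)
      have "beta_density p q t * \<bar>t - y\<bar> powr - b \<le> \<delta> powr - b * beta_density p q t + C * power_envelope (- b) (- 2) (t - y)"
      proof (cases "\<bar>t - y\<bar> \<ge> \<delta>")
        case True
        then have "\<bar>t - y\<bar> powr - b \<le> \<delta> powr - b"
          using assms \<delta> by (intro powr_mono2') auto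
        from mult_right_mono[OF this, of "beta_density p q t"] show ?thesis
          using C env0 by (simp add: mult.commute add_increasing2)
      next
        case False
        show ?thesis
        proof (cases "0 < t \<and> t < 1")
          case t: True
          have "2 * \<delta> \<le> \<bar>y\<bar>" "2 * \<delta> \<le> \<bar>1 - y\<bar>" by (auto simp: \<delta>_def)
          then have td: "t \<ge> \<delta>" "1 - t \<ge> \<delta>" "\<delta> < 1"
            using False t by linarith+
          have bd: "x powr r \<le> \<delta> powr r + 1" if "x \<ge> \<delta>" "x \<le> 1" for x r :: real
          proof (cases "r \<ge> 0")
            case True
            then have "x powr r \<le> 1" using that \<delta> by (intro powr_le1) auto
            then show ?thesis by (simp add: add_increasing)
          next
            case False
            then have "x powr r \<le> \<delta> powr r" using that \<delta> by (intro powr_mono2') auto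
            then show ?thesis by simp
          qed
          have "beta_density p q t \<le> C" unfolding beta_density_def C_def
            using t td by (auto intro!: mult_mono bd add_nonneg_nonneg)
          then have "beta_density p q t * \<bar>t - y\<bar> powr - b \<le> C * \<bar>t - y\<bar> powr - b"
            by (intro mult_right_mono) auto
          moreover have env: "\<bar>t - y\<bar> powr - b = power_envelope (- b) (- 2) (t - y)"
            using False td by (simp add: power_envelope_def)
          ultimately show ?thesis unfolding env by (intro add_increasing) auto
        next
          case False
          then show ?thesis using C env0 by (auto simp: beta_density_eq_0 not_less)
        qed
      qed
      moreover have "0 \<le> \<delta> powr - b * beta_density p q t" "0 \<le> C * power_envelope (- b) (- 2) (t - y)"
        "0 \<le> beta_density p q t * \<bar>t - y\<bar> powr - b"
        using C env0 by auto
      ultimately show "norm (beta_density p q t * \<bar>t - y\<bar> powr - b) \<le>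
        norm (\<delta> powr - b * beta_density p q t + (C * power_envelope (- b) (- 2) (t - y) + \<delta> powr - b * beta_density p q t))"
        unfolding real_norm_def by linarith
    qed
  qed measurable
qed

section \<open>The inverse transform for \<open>b < 1\<close>\<close>

text \<open>With the damping, the modulus of the double integrand is a product of an integrable
  function of \<omega> and the Beta density, so Fubini applies.\<close>

lemma damped_symbol_integral:
  assumes b: "0 < b" and p: "p > 0" and q: "q > 0" and e: "\<epsilon> > 0"
  shows "of_real (Beta p q) * (LINT \<omega>|lborel. fourier_integrand (kummer_symbol p b (p + q)) y \<omega> * of_real (exp (- \<epsilon> * \<bar>\<omega>\<bar>))) =
    (LINT t|lborel. of_real (beta_density p q t) * power_kernel b \<epsilon> (t - y))"
proof -
  define F where "F = (\<lambda>\<omega> t. damped_power b \<epsilon> \<omega> * (of_real (beta_density p q t) * exp (\<i> * of_real \<omega> * of_real (t - y))))"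
  have nF: "norm (F \<omega> t) = norm (damped_power b \<epsilon> \<omega>) * beta_density p q t" for \<omega> t
    by (simp add: F_def norm_mult del: of_real_diff)
  have Fm: "case_prod F \<in> borel_measurable (lborel \<Otimes>\<^sub>M lborel)"
    unfolding F_def by measurable
  have Fint: "integrable (lborel \<Otimes>\<^sub>M lborel) (case_prod F)"
  proof (rule lborel_pair.Fubini_integrable[OF Fm])
    have "integrable lborel (\<lambda>\<omega>. norm (damped_power b \<epsilon> \<omega>) * (LINT t|lborel. beta_density p q t))"
      by (intro integrable_mult_left integrable_norm integrable_damped_power b e)
    then show "integrable lborel (\<lambda>\<omega>. LINT t|lborel. norm (case (\<omega>, t) of (x, y) \<Rightarrow> F x y))"
      by (simp add: nF)
    have "integrable lborel (F \<omega>)" for \<omega>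
      unfolding F_def
      by (intro integrable_mult_right integrable_beta_density_bounded[where C=1] p q) (auto simp del: of_real_diff)
    then show "AE \<omega> in lborel. integrable lborel (\<lambda>t. case (\<omega>, t) of (x, y) \<Rightarrow> F x y)" by simp
  qed
  have "of_real (Beta p q) * (LINT \<omega>|lborel. fourier_integrand (kummer_symbol p b (p + q)) y \<omega> * of_real (exp (- \<epsilon> * \<bar>\<omega>\<bar>)))
     = (LINT \<omega>|lborel. of_real (Beta p q) * (fourier_integrand (kummer_symbol p b (p + q)) y \<omega> * of_real (exp (- \<epsilon> * \<bar>\<omega>\<bar>))))"
    by simp
  also have "\<dots> = (LINT \<omega>|lborel. LINT t|lborel. F \<omega> t)"
  proof (rule Bochner_Integration.integral_cong)
    fix \<omega> :: real
    have "of_real (Beta p q) * (fourier_integrand (kummer_symbol p b (p + q)) y \<omega> * of_real (exp (- \<epsilon> * \<bar>\<omega>\<bar>))) =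
       damped_power b \<epsilon> \<omega> * exp (- (\<i> * of_real \<omega> * of_real y)) * (of_real (Beta p q) * kummer_M (of_real p) (of_real (p + q)) (\<i> * of_real \<omega>))"
      by (simp add: fourier_integrand_def kummer_symbol_def damped_power_def mult_ac del: of_real_diff)
    also have "\<dots> = damped_power b \<epsilon> \<omega> * exp (- (\<i> * of_real \<omega> * of_real y)) * (LINT t|lborel. of_real (beta_density p q t) * exp (\<i> * of_real \<omega> * of_real t))"
      by (simp only: kummer_M_integral[OF p q])
    also have "\<dots> = (LINT t|lborel. damped_power b \<epsilon> \<omega> * exp (- (\<i> * of_real \<omega> * of_real y)) * (of_real (beta_density p q t) * exp (\<i> * of_real \<omega> * of_real t)))"
      by simp
    also have "\<dots> = (LINT t|lborel. F \<omega> t)"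
      by (intro Bochner_Integration.integral_cong)
         (simp_all add: F_def right_diff_distrib exp_diff exp_minus field_simps)
    finally show "of_real (Beta p q) * (fourier_integrand (kummer_symbol p b (p + q)) y \<omega> * of_real (exp (- \<epsilon> * \<bar>\<omega>\<bar>))) = (LINT t|lborel. F \<omega> t)" .
  qed simp
  also have "\<dots> = (LINT t|lborel. LINT \<omega>|lborel. F \<omega> t)"
    by (rule lborel_pair.Fubini_integral[OF Fint, symmetric])
  also have "\<dots> = (LINT t|lborel. of_real (beta_density p q t) * power_kernel b \<epsilon> (t - y))"
  proof (rule Bochner_Integration.integral_cong)
    fix t :: real
    have "(LINT \<omega>|lborel. F \<omega> t) = (LINT \<omega>|lborel. of_real (beta_density p q t) * (damped_power b \<epsilon> \<omega> * exp (\<i> * of_real \<omega> * of_real (t - y))))"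
      by (intro Bochner_Integration.integral_cong) (simp_all add: F_def mult_ac)
    also have "\<dots> = of_real (beta_density p q t) * (LINT \<omega>|lborel. damped_power b \<epsilon> \<omega> * exp (\<i> * of_real \<omega> * of_real (t - y)))"
      by (simp del: of_real_diff)
    finally show "(LINT \<omega>|lborel. F \<omega> t) = of_real (beta_density p q t) * power_kernel b \<epsilon> (t - y)"
      using has_bochner_integral_damped_power[OF b e, of "t - y"] by (simp only: has_bochner_integral_iff)
  qed simp
  finally show ?thesis .
qed

text \<open>Both sides of \<open>damped_symbol_integral\<close> pass to the limit by dominated
  convergence: the left under the modulus of the symbol, the right under the density times 2
  Gamma(b) |t - y|^(-b).\<close>

lemma inverse_fourier_kummer_symbol_integral:
  assumes b: "0 < b" "b < 1" "b < min p q" and y: "y \<noteq> 0" "y \<noteq> 1"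
  shows "inverse_fourier (kummer_symbol p b (p + q)) y =
    of_real (sqrt (2 * pi) * rGamma (1 - b) / Beta p q *
      (LINT t|lborel. beta_density p q t * (indicator {y<..} t * (t - y) powr - b)))"
proof -
  have pq: "p > 0" "q > 0" using b by auto
  define e where "e = (\<lambda>n. inverse (real (Suc n)))"
  have e: "e \<longlonglongrightarrow> 0" "e n > 0" for n
    unfolding e_def using LIMSEQ_inverse_real_of_nat by auto
  define S where "S = fourier_integrand (kummer_symbol p b (p + q)) y"
  have S: "integrable lborel S"
    unfolding S_def using b by (intro integrable_fourier_integrand integrable_kummer_symbol) auto
  have 1: "(\<lambda>n. LINT \<omega>|lborel. S \<omega> * of_real (exp (- e n * \<bar>\<omega>\<bar>))) \<longlonglongrightarrow> (LINT \<omega>|lborel. S \<omega>)"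
  proof (rule integral_dominated_convergence[where w = "\<lambda>\<omega>. norm (S \<omega>)"])
    have "(\<lambda>n. S \<omega> * of_real (exp (- e n * \<bar>\<omega>\<bar>))) \<longlonglongrightarrow> S \<omega> * of_real (exp (- 0 * \<bar>\<omega>\<bar>))" for \<omega>
      by (intro tendsto_intros e)
    then show "AE \<omega> in lborel. (\<lambda>n. S \<omega> * of_real (exp (- e n * \<bar>\<omega>\<bar>))) \<longlonglongrightarrow> S \<omega>" by simp
    show "AE \<omega> in lborel. norm (S \<omega> * of_real (exp (- e n * \<bar>\<omega>\<bar>))) \<le> norm (S \<omega>)" for n
      using e(2)[of n] by (intro AE_I2) (auto simp: norm_mult intro!: mult_left_le)
  qed (use S in auto)
  define G where "G = (\<lambda>t. beta_density p q t * (2 * pi * rGamma (1 - b) * (indicator {0<..} (t - y) * (t - y) powr - b)))"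
  have 2: "(\<lambda>n. LINT t|lborel. of_real (beta_density p q t) * power_kernel b (e n) (t - y)) \<longlonglongrightarrow>
      (LINT t|lborel. complex_of_real (G t))"
  proof (rule integral_dominated_convergence[where w = "\<lambda>t. 2 * Gamma b * (beta_density p q t * \<bar>t - y\<bar> powr - b)"])
    show "integrable lborel (\<lambda>t. 2 * Gamma b * (beta_density p q t * \<bar>t - y\<bar> powr - b))"
      by (intro integrable_mult_right integrable_beta_density_powr_diff pq b y)
    have ne: "AE t in lborel. t \<noteq> y" by (rule AE_lborel_singleton)
    show "AE t in lborel. (\<lambda>n. of_real (beta_density p q t) * power_kernel b (e n) (t - y)) \<longlonglongrightarrow> complex_of_real (G t)"
      using ne
    proof eventually_elim
      case (elim t)
      show ?case unfolding G_def of_real_mult[of "beta_density p q t"]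
        by (intro tendsto_mult tendsto_const tendsto_power_kernel b e) (use elim in auto)
    qed
    show "AE t in lborel. norm (of_real (beta_density p q t) * power_kernel b (e n) (t - y)) \<le>
       2 * Gamma b * (beta_density p q t * \<bar>t - y\<bar> powr - b)" for n
      using ne
    proof eventually_elim
      case (elim t)
      have "norm (power_kernel b (e n) (t - y)) \<le> 2 * Gamma b * \<bar>t - y\<bar> powr - b"
        by (rule norm_power_kernel_le) (use b elim in auto)
      from mult_left_mono[OF this, of "beta_density p q t"] show ?case
        by (simp add: norm_mult mult_ac)
    qed
    show "(\<lambda>t. complex_of_real (G t)) \<in> borel_measurable lborel" unfolding G_def by measurable
    show "(\<lambda>t. of_real (beta_density p q t) * power_kernel b (e n) (t - y)) \<in> borel_measurable lborel" for n
    proof -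
      note [measurable] = borel_measurable_power_kernel[OF e(2)[of n]]
      show ?thesis by measurable
    qed
  qed
  have "(\<lambda>n. of_real (Beta p q) * (LINT \<omega>|lborel. S \<omega> * of_real (exp (- e n * \<bar>\<omega>\<bar>)))) \<longlonglongrightarrow> of_real (Beta p q) * (LINT \<omega>|lborel. S \<omega>)"
    by (intro tendsto_mult tendsto_const 1)
  then have "of_real (Beta p q) * (LINT \<omega>|lborel. S \<omega>) = (LINT t|lborel. complex_of_real (G t))"
    unfolding S_def damped_symbol_integral[OF b(1) pq e(2)] using 2 LIMSEQ_unique by blast
  also have "\<dots> = of_real (LINT t|lborel. G t)" by simp
  also have "(LINT t|lborel. G t) = (LINT t|lborel. 2 * pi * rGamma (1 - b) * (beta_density p q t * (indicator {y<..} t * (t - y) powr - b)))"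
    by (intro Bochner_Integration.integral_cong) (auto simp: G_def indicator_def)
  also have "\<dots> = 2 * pi * rGamma (1 - b) * (LINT t|lborel. beta_density p q t * (indicator {y<..} t * (t - y) powr - b))"
    by simp
  finally have *: "of_real (Beta p q) * (LINT \<omega>|lborel. S \<omega>) =
    complex_of_real (2 * pi * rGamma (1 - b) * (LINT t|lborel. beta_density p q t * (indicator {y<..} t * (t - y) powr - b)))" .
  have B: "Beta p q > 0" using pq by (auto simp: Beta_def)
  have "(LINT \<omega>|lborel. S \<omega>) = complex_of_real (2 * pi * rGamma (1 - b) / Beta p q * (LINT t|lborel. beta_density p q t * (indicator {y<..} t * (t - y) powr - b)))"
    using * B by (simp add: field_simps)
  then have "inverse_fourier (kummer_symbol p b (p + q)) y = of_real (1 / sqrt (2 * pi) *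
      (2 * pi * rGamma (1 - b) / Beta p q * (LINT t|lborel. beta_density p q t * (indicator {y<..} t * (t - y) powr - b))))"
    unfolding inverse_fourier_def S_def[symmetric] by simp
  moreover have "1 / sqrt (2 * pi) * (2 * pi * r / B * I) = sqrt (2 * pi) * r / B * I" for r B I :: real
  proof -
    define w where "w = sqrt (2 * pi)"
    have w: "w > 0" "2 * pi = w * w" by (auto simp: w_def)
    show ?thesis unfolding w_def[symmetric] w(2) using w(1) by simp
  qed
  ultimately show ?thesis by (simp only:)
qed

text \<open>Binomial expansion of (1 - zt)^(-s). For z \<ge> 0 all terms are nonnegative, so
  convergence of the Gauss series already justifies integrating term by term.\<close>

lemma gauss_F_Euler_integral:
  fixes p q s z :: real
  assumes "p > 0" "q > 0" "s > 0" "0 \<le> z" "z < 1"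
  shows "(LINT t|lborel. beta_density p q t * (1 - z * t) powr - s) = Beta p q * gauss_F s p (p + q) z"
proof -
  define f where "f = (\<lambda>k t. beta_density p q t * (((- s) gchoose k) * (- (z * t)) ^ k))"
  have fk: "f k t = beta_density (p + real k) q t * (pochhammer s k / fact k * z ^ k)" for k t
  proof -
    have "(- 1) ^ k * (- 1) ^ k = (1::real)" by (simp flip: power_mult_distrib)
    then have e: "((- s) gchoose k) * (- (z * t)) ^ k = pochhammer s k / fact k * z ^ k * t ^ k"
      by (simp add: gbinomial_pochhammer power_minus[of "z * t"] power_mult_distrib)
    show ?thesis unfolding f_def e by (simp add: mult_ac flip: beta_density_power)
  qed
  have hf: "has_bochner_integral lborel (f k) (Beta (p + real k) q * (pochhammer s k / fact k * z ^ k))" for k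
    unfolding fk[abs_def]
    by (intro has_bochner_integral_mult_left has_bochner_integral_beta_density) (use assms in auto)
  have f0: "f k t \<ge> 0" for k t
    unfolding fk using assms by (intro mult_nonneg_nonneg divide_nonneg_nonneg pochhammer_nonneg) auto
  have S: "(\<lambda>k. f k t) sums (beta_density p q t * (1 - z * t) powr - s)" for t
  proof (cases "0 < t \<and> t < 1")
    case True
    then have "z * t \<le> t" "0 \<le> z * t" using assms by (auto intro: mult_left_le_one_le)
    then have "\<bar>- (z * t)\<bar> < 1" using True by linarith
    then show ?thesis unfolding f_def using gen_binomial_real[of "- (z * t)" "-s"]
      by (intro sums_mult) simp
  next
    case False
    then show ?thesis by (auto simp: f_def beta_density_eq_0 not_less)
  qed
  have int: "integrable lborel (f k)" for k using hf has_bochner_integral_iff by blast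
  have val: "(LINT t|lborel. f k t) = Beta p q * (pochhammer s k * pochhammer p k / pochhammer (p + q) k * (z ^ k / fact k))" for k
    using hf[of k] Beta_add_of_nat_left[OF assms(1,2), of k] by (simp add: has_bochner_integral_iff mult_ac)
  have F: "(\<lambda>k. LINT t|lborel. f k t) sums (Beta p q * gauss_F s p (p + q) z)"
    unfolding val by (intro sums_mult gauss_F_sums) (use assms in auto)
  have "(\<lambda>k. LINT t|lborel. f k t) sums (\<integral>t. (\<Sum>k. f k t) \<partial>lborel)"
  proof (rule sums_integral[OF int])
    show "AE t in lborel. summable (\<lambda>k. norm (f k t))"
      using S f0 by (intro AE_I2) (auto simp: sums_iff)
    show "summable (\<lambda>k. LINT t|lborel. norm (f k t))"
      using F f0 by (simp add: sums_iff)
  qed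
  moreover have "(\<Sum>k. f k t) = beta_density p q t * (1 - z * t) powr - s" for t
    using S sums_unique by metis
  ultimately show ?thesis using F sums_unique2 by simp
qed

text \<open>Factoring t - y directly would give the argument 1/y, possibly outside the unit disc.
  After reflecting t to 1 - t, the factor is (1 - y)(1 - wt) with w = 1/(1 - y) in (0, 1).\<close>

lemma beta_convolution_left:
  assumes "p > 0" "q > 0" "b > 0" "y < 0"
  shows "(LINT t|lborel. beta_density p q t * (indicator {y<..} t * (t - y) powr - b)) =
           Beta p q * ((1 - y) powr - b * gauss_F b q (p + q) (1 / (1 - y)))"
proof -
  define w where "w = 1 / (1 - y)"
  have w: "0 \<le> w" "w < 1" using assms by (auto simp: w_def)
  have "(LINT t|lborel. beta_density p q t * (indicator {y<..} t * (t - y) powr - b)) =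
    (LINT t|lborel. beta_density q p t * (indicator {y<..} (1 - t) * (1 - t - y) powr - b))"
    by (subst lborel_integral_real_affine[of "-1" _ 1]) (simp_all add: beta_density_swap)
  also have "\<dots> = (LINT t|lborel. (1 - y) powr - b * (beta_density q p t * (1 - w * t) powr - b))"
  proof (rule Bochner_Integration.integral_cong)
    fix t :: real
    show "beta_density q p t * (indicator {y<..} (1 - t) * (1 - t - y) powr - b) =
        (1 - y) powr - b * (beta_density q p t * (1 - w * t) powr - b)"
    proof (cases "0 < t \<and> t < 1")
      case True
      have e: "1 - t - y = (1 - y) * (1 - w * t)" using assms by (simp add: w_def field_simps)
      have "w * t \<le> t" using True w by (intro mult_left_le_one_le) auto
      then have "1 - w * t > 0" using True by linarith
      then have "(1 - t - y) powr - b = (1 - y) powr - b * (1 - w * t) powr - b"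
        unfolding e using assms by (simp add: powr_mult)
      then show ?thesis using True assms by simp
    next
      case False
      then show ?thesis by (auto simp: beta_density_eq_0 not_less)
    qed
  qed simp
  also have "\<dots> = (1 - y) powr - b * (Beta q p * gauss_F b q (q + p) w)"
    using gauss_F_Euler_integral[of q p b w] assms w by simp
  finally show ?thesis by (simp add: w_def Beta_commute[of q p] add.commute[of q p] mult_ac)
qed

text \<open>The substitution \<open>t = y / (1 - z u)\<close> with \<open>z = 1 - y\<close> maps \<open>[0, 1]\<close> onto \<open>[y, 1]\<close> and produces
  the Gauss function directly in the form in which it appears in the theorem, so that Euler's
  transformation is not needed.\<close>

lemma beta_convolution_middle:
  assumes "p > 0" "q > 0" "0 < b" "b < 1" "b < p + q" "0 < y" "y < 1"
  shows "(LINT t|lborel. beta_density p q t * (indicator {y<..} t * (t - y) powr - b)) =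
           y powr (p - b) * (1 - y) powr (q - b) * (Beta (1 - b) q * gauss_F (1 - b) (p + q - b) (1 - b + q) (1 - y))"
proof -
  define z where "z = 1 - y"
  have z: "0 < z" "z < 1" "y = 1 - z" using assms by (auto simp: z_def)
  define g where "g = (\<lambda>u. y / (1 - z * u))"
  define g' where "g' = (\<lambda>u. y * z / (1 - z * u)\<^sup>2)"
  define f where "f = (\<lambda>t. t powr (p - 1) * (1 - t) powr (q - 1) * (t - y) powr - b)"
  have pos: "1 - z * u > 0" if "u \<in> {0..1}" for u
  proof -
    have "z * u \<le> z" using that z by (intro mult_left_le) auto
    then show ?thesis using z by linarith
  qed
  have g01: "g 0 = y" "g 1 = 1" using z by (auto simp: g_def)
  have ind: "f t * indicator {y..1} t = beta_density p q t * (indicator {y<..} t * (t - y) powr - b)" for t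
    using assms by (auto simp: f_def beta_density_def indicator_def)
  have fint: "set_integrable lborel {g 0..g 1} f"
  proof -
    have "integrable lborel (\<lambda>t. indicator {y<..} t *\<^sub>R (beta_density p q t * \<bar>t - y\<bar> powr - b))"
      by (intro integrable_mult_indicator integrable_beta_density_powr_diff) (use assms in auto)
    also have "(\<lambda>t. indicator {y<..} t *\<^sub>R (beta_density p q t * \<bar>t - y\<bar> powr - b)) = (\<lambda>t. indicator {g 0..g 1} t *\<^sub>R f t)"
    proof
      fix t show "indicator {y<..} t *\<^sub>R (beta_density p q t * \<bar>t - y\<bar> powr - b) = indicator {g 0..g 1} t *\<^sub>R f t"
        using ind[of t] by (auto simp: g01 indicator_def split: if_splits)
    qed
    finally show ?thesis unfolding set_integrable_def .
  qed
  have "(LINT t|lborel. beta_density p q t * (indicator {y<..} t * (t - y) powr - b)) =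
        (LINT t|lborel. f t * indicator {g 0..g 1} t)"
    by (simp only: ind g01)
  also have "\<dots> = (LINT u|lborel. f (g u) * g' u * indicator {0..1} u)"
  proof (rule integral_substitution(2)[where g = g and a = 0 and b = 1, OF fint])
    show "(g has_real_derivative g' u) (at u)" if "u \<in> {0..1}" for u
      unfolding g_def g'_def using pos[OF that]
      by (auto intro!: derivative_eq_intros simp: power2_eq_square)
    show "continuous_on {0..1} g'"
      unfolding g'_def using pos by (intro continuous_intros) fastforce
    show "g' u \<ge> 0" if "u \<in> {0..1}" for u
      unfolding g'_def using z by simp
  qed simp
  also have "\<dots> = (LINT u|lborel. y powr (p - b) * z powr (q - b) * (beta_density (1 - b) q u * (1 - z * u) powr - (p + q - b)))"
  proof (rule integral_cong_AE)
    have "AE u in lborel. u \<noteq> (0::real)" "AE u in lborel. u \<noteq> (1::real)" by (rule AE_lborel_singleton)+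
    then show "AE u in lborel. f (g u) * g' u * indicator {0..1} u =
       y powr (p - b) * z powr (q - b) * (beta_density (1 - b) q u * (1 - z * u) powr - (p + q - b))"
    proof eventually_elim
      case (elim u)
      show ?case
      proof (cases "0 < u \<and> u < 1")
        case True
        define d where "d = 1 - z * u"
        have d: "d > 0" unfolding d_def using True by (intro pos) auto
        have y: "y > 0" using assms by simp
        have 1: "g u = y / d" by (simp add: g_def d_def)
        have 2: "1 - g u = z * (1 - u) / d" unfolding 1 using d by (simp add: field_simps) (simp add: d_def z algebra_simps)
        have 3: "g u - y = y * z * u / d" unfolding 1 using d by (simp add: field_simps) (simp add: d_def algebra_simps)
        \<comment> \<open>With d = 1 - zu, the powers of u and 1 - u form the density with
          parameters 1 - b and q, and those of d collect to -(p - 1) - (q - 1) + b - 2 = -(p + q -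
          b).\<close>
        have "f (g u) * g' u = (y powr (p - 1) / d powr (p - 1)) * (z powr (q - 1) * (1 - u) powr (q - 1) / d powr (q - 1)) *
            (y powr - b * z powr - b * u powr - b / d powr - b) * (y powr 1 * z powr 1 / d powr 2)"
          unfolding f_def 2 3 unfolding 1 g'_def d_def[symmetric] using True z(1) y d
          by (simp add: powr_mult powr_divide powr_realpow[of d 2, simplified])
        also have "\<dots> = (y powr (p - 1) * y powr - b * y powr 1) * (z powr (q - 1) * z powr - b * z powr 1) *
            (u powr - b * (1 - u) powr (q - 1)) * (inverse (d powr (p - 1)) * inverse (d powr (q - 1)) * inverse (d powr - b) * inverse (d powr 2))"
          by (simp add: divide_inverse mult_ac)
        also have "y powr (p - 1) * y powr - b * y powr 1 = y powr (p - b)"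
          by (simp only: powr_add[symmetric]) (simp add: algebra_simps)
        also have "z powr (q - 1) * z powr - b * z powr 1 = z powr (q - b)"
          by (simp only: powr_add[symmetric]) (simp add: algebra_simps)
        also have "inverse (d powr (p - 1)) * inverse (d powr (q - 1)) * inverse (d powr - b) * inverse (d powr 2) = d powr - (p + q - b)"
          by (simp add: algebra_simps flip: powr_minus powr_add)
        finally show ?thesis using True by (simp add: beta_density_def d_def mult_ac)
      next
        case False
        then show ?thesis using elim by (auto simp: beta_density_eq_0 not_less indicator_def)
      qed
    qed
    show "(\<lambda>u. f (g u) * g' u * indicator {0..1} u) \<in> borel_measurable lborel"
      unfolding f_def g_def g'_def by measurable
    show "(\<lambda>u. y powr (p - b) * z powr (q - b) * (beta_density (1 - b) q u * (1 - z * u) powr - (p + q - b))) \<in> borel_measurable lborel"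
      by measurable
  qed
  also have "\<dots> = y powr (p - b) * z powr (q - b) * (Beta (1 - b) q * gauss_F (p + q - b) (1 - b) (1 - b + q) z)"
    using gauss_F_Euler_integral[of "1 - b" q "p + q - b" z] assms z by simp
  also have "gauss_F (p + q - b) (1 - b) (1 - b + q) z = gauss_F (1 - b) (p + q - b) (1 - b + q) z"
    by (simp add: gauss_F_def mult.commute)
  finally show ?thesis by (simp add: z_def)
qed

section \<open>Continuity in the parameters\<close>

lemma tendsto_gauss_F:
  fixes z :: real
  assumes A: "(A \<longlongrightarrow> A0) F" and B: "(B \<longlongrightarrow> B0) F" and C: "(C \<longlongrightarrow> C0) F"
    and C0: "C0 > 0" and z: "\<bar>z\<bar> < 1" and F: "F \<noteq> bot"
  shows "((\<lambda>n. gauss_F (A n) (B n) (C n) z) \<longlongrightarrow> gauss_F A0 B0 C0 z) F"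
proof -
  \<comment> \<open>The majorant for Tannery's theorem is itself a Gauss series: enlarged numerator
    parameters, a smaller positive denominator parameter, and the argument |z| < 1.\<close>
  define M where "M = (\<lambda>k. pochhammer (\<bar>A0\<bar> + 1) k * pochhammer (\<bar>B0\<bar> + 1) k / pochhammer (C0 / 2) k * (\<bar>z\<bar> ^ k / fact k))"
  have "eventually (\<lambda>n. \<bar>A n\<bar> < \<bar>A0\<bar> + 1) F" "eventually (\<lambda>n. \<bar>B n\<bar> < \<bar>B0\<bar> + 1) F" "eventually (\<lambda>n. C n > C0 / 2) F"
    using order_tendstoD(2)[OF tendsto_rabs[OF A], of "\<bar>A0\<bar> + 1"]
      order_tendstoD(2)[OF tendsto_rabs[OF B], of "\<bar>B0\<bar> + 1"] order_tendstoD(1)[OF C, of "C0 / 2"] C0 by auto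
  then have ev: "eventually (\<lambda>n. \<bar>A n\<bar> < \<bar>A0\<bar> + 1 \<and> \<bar>B n\<bar> < \<bar>B0\<bar> + 1 \<and> C n > C0 / 2) F"
    by eventually_elim auto
  define a where "a = (\<lambda>k n. pochhammer (A n) k * pochhammer (B n) k / pochhammer (C n) k * (z ^ k / fact k))"
  have bd: "norm (a k n) \<le> M k" if "\<bar>A n\<bar> < \<bar>A0\<bar> + 1 \<and> \<bar>B n\<bar> < \<bar>B0\<bar> + 1 \<and> C n > C0 / 2" for k n
  proof -
    have p: "pochhammer (C0 / 2) k > 0" using C0 by (intro pochhammer_pos) auto
    have "pochhammer (C0 / 2) k \<le> pochhammer (C n) k" using C0 that by (intro pochhammer_mono) auto
    moreover have "\<bar>pochhammer (A n) k\<bar> \<le> pochhammer (\<bar>A0\<bar> + 1) k" "\<bar>pochhammer (B n) k\<bar> \<le> pochhammer (\<bar>B0\<bar> + 1) k"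
      using that by (auto intro!: abs_pochhammer_le)
    moreover have "pochhammer (\<bar>A0\<bar> + 1) k \<ge> 0" "pochhammer (\<bar>B0\<bar> + 1) k \<ge> 0" by (intro pochhammer_nonneg; simp)+
    ultimately show ?thesis unfolding a_def M_def using p
      by (auto simp: abs_mult abs_divide power_abs intro!: mult_mono frac_le)
  qed
  have "((\<lambda>n. suminf (\<lambda>k. a k n)) \<longlongrightarrow> suminf (\<lambda>k. pochhammer A0 k * pochhammer B0 k / pochhammer C0 k * (z ^ k / fact k))) F"
  proof (rule tannerys_theorem[THEN conjunct2, THEN conjunct2])
    have P: "((\<lambda>n. pochhammer (X n) k) \<longlongrightarrow> pochhammer x k) F" if "(X \<longlongrightarrow> x) F" for X and x :: real and k
      unfolding pochhammer_prod by (intro tendsto_intros that)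
    show "((\<lambda>n. a k n) \<longlongrightarrow> pochhammer A0 k * pochhammer B0 k / pochhammer C0 k * (z ^ k / fact k)) F" for k
      unfolding a_def using pochhammer_pos[OF C0, of k] by (intro tendsto_intros P A B C) auto
    have "eventually (\<lambda>x. (\<lambda>k. True) (fst x) \<and> (\<lambda>n. \<bar>A n\<bar> < \<bar>A0\<bar> + 1 \<and> \<bar>B n\<bar> < \<bar>B0\<bar> + 1 \<and> C n > C0 / 2) (snd x)) (at_top \<times>\<^sub>F F)"
      by (rule eventually_prodI) (use ev in auto)
    then show "eventually (\<lambda>(k, n). norm (a k n) \<le> M k) (at_top \<times>\<^sub>F F)"
      by eventually_elim (use bd in auto)
    show "summable M" unfolding M_def
      by (rule sums_summable[OF gauss_F_sums]) (use C0 z in auto)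
  qed (rule F)
  then show ?thesis by (simp add: a_def gauss_F_def)
qed

section \<open>The closed form\<close>

text \<open>\<open>rGamma\<close> encodes the convention that 1/Gamma(1 - b) is 0 at positive
  integers b; being entire, it permits limits and recursion there. The points y = 0 and y = 1 fall
  into a neighbouring branch, and nothing is claimed about them.\<close>

definition kummer_inverse :: "real \<Rightarrow> real \<Rightarrow> real \<Rightarrow> real \<Rightarrow> real" where
  "kummer_inverse a b c y =
    (if y > 1 then 0
     else if y > 0 then sqrt (2 * pi) * (Gamma c / (Gamma a * Gamma (1 - a - b + c)))
           * y powr (a - b) * (1 - y) powr (c - a - b)
           * gauss_F (1 - b) (c - b) (c + 1 - a - b) (1 - y)
     else sqrt (2 * pi) * rGamma (1 - b) * (1 / (1 - y) powr b)
           * gauss_F b (c - a) c (1 / (1 - y)))"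

lemma inverse_fourier_kummer_symbol_less_1:
  assumes "0 < b" "b < 1" "b < min a (c - a)" "y \<noteq> 0" "y \<noteq> 1"
  shows "inverse_fourier (kummer_symbol a b c) y = of_real (kummer_inverse a b c y)"
proof -
  define q where "q = c - a"
  have c: "c = a + q" and q: "q > 0" and a: "a > 0" using assms by (auto simp: q_def)
  define I where "I = (LINT t|lborel. beta_density a q t * (indicator {y<..} t * (t - y) powr - b))"
  have B: "Beta a q > 0" using a q by (auto simp: Beta_def)
  consider "y > 1" | "0 < y" "y < 1" | "y < 0" using assms by linarith
  then have "sqrt (2 * pi) * rGamma (1 - b) / Beta a q * I = kummer_inverse a b (a + q) y"
  proof cases
    case 1
    then have "(\<lambda>t. beta_density a q t * (indicator {y<..} t * (t - y) powr - b)) = (\<lambda>t. 0)"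
      by (auto simp: beta_density_def indicator_def)
    then have "I = 0" unfolding I_def by (simp only:) simp
    then show ?thesis using 1 by (simp add: kummer_inverse_def)
  next
    case 2
    have I: "I = y powr (a - b) * (1 - y) powr (q - b) * (Beta (1 - b) q * gauss_F (1 - b) (a + q - b) (1 - b + q) (1 - y))"
      unfolding I_def by (rule beta_convolution_middle) (use assms 2 a q in \<open>auto simp: c\<close>)
    have G: "Gamma a > 0" "Gamma q > 0" "Gamma (1 - b) > 0" "Gamma (a + q) > 0" "Gamma (1 - b + q) > 0"
      using a q assms by auto
    \<comment> \<open>The 1/Gamma(1 - b) of the kernel cancels against the Beta factor of the
      convolution, so this branch keeps no factor that vanishes at integer b.\<close>
    have "rGamma (1 - b) * Beta (1 - b) q / Beta a q = Gamma (a + q) / (Gamma a * Gamma (1 - b + q))"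
      using G by (simp add: Beta_def rGamma_inverse_Gamma field_simps)
    moreover have "s * r / B * (u * v * (B1 * F)) = s * (r * B1 / B) * u * v * F" for s r B u v B1 F :: real
      by simp
    ultimately have "sqrt (2 * pi) * rGamma (1 - b) / Beta a q * I = sqrt (2 * pi) * (Gamma (a + q) / (Gamma a * Gamma (1 - b + q)))
         * y powr (a - b) * (1 - y) powr (q - b) * gauss_F (1 - b) (a + q - b) (1 - b + q) (1 - y)"
      unfolding I by (simp only:)
    moreover have "1 - a - b + (a + q) = 1 - b + q" "a + q - a - b = q - b" "a + q + 1 - a - b = 1 - b + q" by auto
    ultimately show ?thesis using 2 unfolding kummer_inverse_def by (simp only:) simp
  next
    case 3
    have I: "I = Beta a q * ((1 - y) powr - b * gauss_F b q (a + q) (1 / (1 - y)))"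
      unfolding I_def by (rule beta_convolution_left) (use assms 3 a q in auto)
    show ?thesis using B 3 unfolding I kummer_inverse_def
      by (simp add: powr_minus_divide)
  qed
  then show ?thesis
    using inverse_fourier_kummer_symbol_integral[of b a q y] assms unfolding c I_def by simp
qed

lemma inverse_fourier_kummer_symbol_eq_1:
  assumes "1 < min a (c - a)" "y \<noteq> 0" "y \<noteq> 1"
  shows "inverse_fourier (kummer_symbol a 1 c) y = of_real (kummer_inverse a 1 c y)"
proof -
  \<comment> \<open>Increases to 1 inside [1/2, 1), so every b = \<open>B n\<close> is covered by
    the case b < 1 and stays away from 0.\<close>
  define B where "B = (\<lambda>n. 1 - inverse (real (Suc (Suc n))))"
  have Bl: "B \<longlonglongrightarrow> 1"
  proof -
    have "(\<lambda>n. 1 - inverse (real (Suc (Suc n)))) \<longlonglongrightarrow> 1 - 0"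
      by (intro tendsto_diff tendsto_const LIMSEQ_Suc[OF LIMSEQ_inverse_real_of_nat])
    then show ?thesis by (simp add: B_def)
  qed
  have Bb: "1 / 2 \<le> B n" "B n < 1" for n by (auto simp: B_def field_simps)
  define m where "m = min a (c - a)"
  obtain K where K: "K \<ge> 0"
    "\<And>b \<omega>. norm (kummer_symbol a b c \<omega>) \<le> K * power_envelope (b - 1) (b - 1 - min a (c - a)) \<omega>"
    using kummer_symbol_bound[of a c] assms by auto
  have "(\<lambda>n. LINT \<omega>|lborel. fourier_integrand (kummer_symbol a (B n) c) y \<omega>) \<longlonglongrightarrow>
     (LINT \<omega>|lborel. fourier_integrand (kummer_symbol a 1 c) y \<omega>)"
  \<comment> \<open>The worst exponents over b in [1/2, 1): -1/2 at the origin, from b = 1/2, and -m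
    at infinity, from b = 1; m > 1 by hypothesis.\<close>
  proof (rule integral_dominated_convergence[where w = "\<lambda>\<omega>. K * power_envelope (- 1 / 2) (- m) \<omega>"])
    show "integrable lborel (\<lambda>\<omega>. K * power_envelope (- 1 / 2) (- m) \<omega>)"
      by (intro integrable_mult_right integrable_power_envelope) (use assms in \<open>auto simp: m_def\<close>)
    show "AE \<omega> in lborel. norm (fourier_integrand (kummer_symbol a (B n) c) y \<omega>) \<le> K * power_envelope (- 1 / 2) (- m) \<omega>" for n
    proof (rule AE_I2)
      fix \<omega> :: real
      have "power_envelope (B n - 1) (B n - 1 - m) \<omega> \<le> power_envelope (- 1 / 2) (- m) \<omega>"
        using Bb[of n] by (auto simp: power_envelope_def intro: powr_mono powr_mono')
      from mult_left_mono[OF this K(1)] show "norm (fourier_integrand (kummer_symbol a (B n) c) y \<omega>) \<le> K * power_envelope (- 1 / 2) (- m) \<omega>"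
        using K(2)[of "B n" \<omega>] unfolding norm_fourier_integrand m_def by linarith
    qed
    have "AE \<omega> in lborel. \<omega> \<noteq> (0::real)" by (rule AE_lborel_singleton)
    then show "AE \<omega> in lborel. (\<lambda>n. fourier_integrand (kummer_symbol a (B n) c) y \<omega>) \<longlonglongrightarrow> fourier_integrand (kummer_symbol a 1 c) y \<omega>"
    proof eventually_elim
      case (elim \<omega>)
      show ?case unfolding fourier_integrand_def kummer_symbol_def imaginary_powr_of_real
        by (intro tendsto_intros Bl) (use elim in auto)
    qed
  qed simp_all
  then have L: "(\<lambda>n. inverse_fourier (kummer_symbol a (B n) c) y) \<longlonglongrightarrow> inverse_fourier (kummer_symbol a 1 c) y"
    unfolding inverse_fourier_def by (intro tendsto_mult tendsto_const)
  have "(\<lambda>n. kummer_inverse a (B n) c y) \<longlonglongrightarrow> kummer_inverse a 1 c y"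
  proof -
    consider "y > 1" | "0 < y" "y < 1" | "y < 0" using assms by linarith
    then show ?thesis
    proof cases
      case 1
      then show ?thesis by (simp add: kummer_inverse_def)
    next
      case 2
      have G: "(\<lambda>n. gauss_F (1 - B n) (c - B n) (c + 1 - a - B n) (1 - y)) \<longlonglongrightarrow> gauss_F (1 - 1) (c - 1) (c + 1 - a - 1) (1 - y)"
        by (intro tendsto_gauss_F tendsto_intros Bl) (use assms 2 in auto)
      have Ga: "(\<lambda>n. Gamma (1 - a - B n + c)) \<longlonglongrightarrow> Gamma (1 - a - 1 + c)"
        by (intro tendsto_Gamma tendsto_intros Bl) (use assms in \<open>auto elim!: nonpos_Ints_cases\<close>)
      have nz: "Gamma a * Gamma (1 - a - 1 + c) \<noteq> 0"
      proof -
        have "Gamma a > 0" "Gamma (1 - a - 1 + c) > 0"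
          by (intro Gamma_real_pos; use assms in simp)+
        then show ?thesis by simp
      qed
      have "(\<lambda>n. sqrt (2 * pi) * (Gamma c / (Gamma a * Gamma (1 - a - B n + c)))
           * y powr (a - B n) * (1 - y) powr (c - a - B n)
           * gauss_F (1 - B n) (c - B n) (c + 1 - a - B n) (1 - y)) \<longlonglongrightarrow>
        sqrt (2 * pi) * (Gamma c / (Gamma a * Gamma (1 - a - 1 + c)))
           * y powr (a - 1) * (1 - y) powr (c - a - 1)
           * gauss_F (1 - 1) (c - 1) (c + 1 - a - 1) (1 - y)"
        by (intro tendsto_mult tendsto_const tendsto_divide Ga G nz tendsto_powr tendsto_diff Bl) (use 2 in auto)
      then show ?thesis using 2 by (simp add: kummer_inverse_def)
    next
      case 3
      have G: "(\<lambda>n. gauss_F (B n) (c - a) c (1 / (1 - y))) \<longlonglongrightarrow> gauss_F 1 (c - a) c (1 / (1 - y))"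
        by (intro tendsto_gauss_F tendsto_intros Bl) (use assms 3 in auto)
      \<comment> \<open>The limit is 0, so at b = 1 the branch y < 0 vanishes.\<close>
      have "(\<lambda>n. rGamma (1 - B n)) \<longlonglongrightarrow> rGamma (1 - 1)"
        by (intro isCont_tendsto_compose[OF isCont_rGamma] tendsto_diff tendsto_const Bl) simp
      then have "(\<lambda>n. sqrt (2 * pi) * rGamma (1 - B n) * (1 / (1 - y) powr B n) * gauss_F (B n) (c - a) c (1 / (1 - y)))
        \<longlonglongrightarrow> sqrt (2 * pi) * rGamma (1 - 1) * (1 / (1 - y) powr 1) * gauss_F 1 (c - a) c (1 / (1 - y))"
        by (intro tendsto_mult tendsto_const tendsto_divide tendsto_powr G Bl) (use 3 in auto)
      then show ?thesis using 3 by (simp add: kummer_inverse_def)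
    qed
  qed
  then have "(\<lambda>n. complex_of_real (kummer_inverse a (B n) c y)) \<longlonglongrightarrow> of_real (kummer_inverse a 1 c y)"
    by (rule tendsto_of_real)
  moreover have "inverse_fourier (kummer_symbol a (B n) c) y = of_real (kummer_inverse a (B n) c y)" for n
    using Bb[of n] assms by (intro inverse_fourier_kummer_symbol_less_1) auto
  ultimately show ?thesis using L LIMSEQ_unique by auto
qed

text \<open>One factor i\<omega> of (i\<omega>)^(b - 1) is absorbed into M by
  \<open>kummer_M_contiguous\<close>. Integrability of both lowered symbols allows the integral to
  be split.\<close>

lemma inverse_fourier_kummer_symbol_contiguous:
  assumes "1 < b" "b < min a (c - a)"
  shows "inverse_fourier (kummer_symbol a b c) y = of_real (c - 1) *
    (inverse_fourier (kummer_symbol a (b - 1) (c - 1)) y - inverse_fourier (kummer_symbol (a - 1) (b - 1) (c - 1)) y)"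
proof -
  define S1 where "S1 = fourier_integrand (kummer_symbol a (b - 1) (c - 1)) y"
  define S2 where "S2 = fourier_integrand (kummer_symbol (a - 1) (b - 1) (c - 1)) y"
  have S: "integrable lborel S1" "integrable lborel S2" unfolding S1_def S2_def
    using assms by (intro integrable_fourier_integrand integrable_kummer_symbol; auto)+
  have "fourier_integrand (kummer_symbol a b c) y \<omega> = of_real (c - 1) * (S1 \<omega> - S2 \<omega>)" for \<omega>
  proof (cases "\<omega> = 0")
    \<comment> \<open>The power law used below fails at the base 0, but there every symbol is 0 by
      the convention for \<open>powr\<close>.\<close>
    case True
    then show ?thesis by (simp add: S1_def S2_def fourier_integrand_def kummer_symbol_def)
  next
    case False
    have "(\<i> * complex_of_real \<omega>) powr of_real (b - 1) = (\<i> * of_real \<omega>) powr (of_real (b - 1 - 1) + 1)"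
      by simp
    also have "\<dots> = (\<i> * of_real \<omega>) powr of_real (b - 1 - 1) * (\<i> * of_real \<omega>)"
      using False by (simp only: powr_add) simp
    finally have "kummer_symbol a b c \<omega> = (\<i> * of_real \<omega>) powr of_real (b - 1 - 1) *
        (\<i> * of_real \<omega> * kummer_M (of_real a) (of_real c) (\<i> * of_real \<omega>))"
      by (simp only: kummer_symbol_def mult.assoc)
    also have "\<i> * of_real \<omega> * kummer_M (of_real a) (of_real c) (\<i> * of_real \<omega>) = of_real (c - 1) *
        (kummer_M (of_real a) (of_real (c - 1)) (\<i> * of_real \<omega>) - kummer_M (of_real (a - 1)) (of_real (c - 1)) (\<i> * of_real \<omega>))"
      by (rule kummer_M_contiguous) (use assms in auto)
    finally show ?thesis
      unfolding S1_def S2_def fourier_integrand_def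
      by (simp only:) (simp add: kummer_symbol_def algebra_simps del: of_real_diff)
  qed
  then have "(LINT \<omega>|lborel. fourier_integrand (kummer_symbol a b c) y \<omega>) =
      of_real (c - 1) * ((LINT \<omega>|lborel. S1 \<omega>) - (LINT \<omega>|lborel. S2 \<omega>))"
    using S by (simp del: of_real_diff)
  then show ?thesis
    unfolding inverse_fourier_def S1_def[symmetric] S2_def[symmetric]
    by (simp add: right_diff_distrib mult.left_commute del: of_real_diff)
qed

lemma kummer_inverse_contiguous:
  assumes "1 < b" "b < min a (c - a)" "y \<noteq> 0" "y \<noteq> 1"
  shows "kummer_inverse a b c y = (c - 1) * (kummer_inverse a (b - 1) (c - 1) y - kummer_inverse (a - 1) (b - 1) (c - 1) y)"
proof -
  consider "y > 1" | "0 < y" "y < 1" | "y < 0" using assms by linarith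
  then show ?thesis
  proof cases
    case 1
    then show ?thesis by (simp add: kummer_inverse_def)
  next
    case 2
    define C where "C = c + 1 - a - b"
    have C: "C > 0" "a > 1" "c > 1" using assms by (auto simp: C_def)
    have G: "Gamma C > 0" "Gamma (a - 1) > 0" "Gamma (c - 1) > 0" using C by auto
    have "x \<notin> \<int>\<^sub>\<le>\<^sub>0" if "x > 0" for x :: real using that by (auto elim!: nonpos_Ints_cases)
    then have Gp: "Gamma a = (a - 1) * Gamma (a - 1)" "Gamma c = (c - 1) * Gamma (c - 1)" "Gamma (C + 1) = C * Gamma C"
      using Gamma_plus1[of "a - 1"] Gamma_plus1[of "c - 1"] Gamma_plus1[of C] C by auto
    \<comment> \<open>\<open>f1\<close> and \<open>f2\<close> are the Gauss functions of the two
      lowered closed forms; \<open>gauss_F_contiguous_2\<close> with A = 2 - b, B = c - b and C - B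
      = 1 - a expresses the original one through them.\<close>
    define f1 where "f1 = gauss_F (2 - b) (c - b) C (1 - y)"
    define f2 where "f2 = gauss_F (2 - b) (c - b) (C + 1) (1 - y)"
    define P where "P = sqrt (2 * pi) * y powr (a - b) * (1 - y) powr (c - a - b)"
    have F: "gauss_F (1 - b) (c - b) C (1 - y) = y * f1 + (1 - a) / C * (1 - y) * f2"
      using gauss_F_contiguous_2[of C "1 - y" "2 - b" "c - b"] C 2
      by (simp add: f1_def f2_def) (simp add: C_def)
    have e: "1 - a - b + c = C" "c + 1 - a - b = C" "1 - (b - 1) = 2 - b" "c - 1 - (b - 1) = c - b"
       "c - 1 + 1 - a - (b - 1) = C" "1 - a - (b - 1) + (c - 1) = C" "c - 1 - a - (b - 1) = c - a - b"
       "1 - (a - 1) - (b - 1) + (c - 1) = C + 1" "c - 1 + 1 - (a - 1) - (b - 1) = C + 1" "a - 1 - (b - 1) = a - b"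
       "c - 1 - (a - 1) - (b - 1) = c - a - b + 1" "a - (b - 1) = a - b + 1"
      by (simp_all add: C_def)
    have y1: "y powr (a - b + 1) = y powr (a - b) * y" "(1 - y) powr (c - a - b + 1) = (1 - y) powr (c - a - b) * (1 - y)"
      using 2 by (simp_all add: powr_add)
    have "kummer_inverse a b c y = Gamma c / (Gamma a * Gamma C) * P * (y * f1 + (1 - a) / C * (1 - y) * f2)"
      using 2 unfolding kummer_inverse_def e F by (simp add: P_def mult_ac)
    moreover have "kummer_inverse a (b - 1) (c - 1) y = Gamma (c - 1) / (Gamma a * Gamma C) * P * y * f1"
      using 2 unfolding kummer_inverse_def e y1 by (simp add: f1_def P_def mult_ac)
    moreover have "kummer_inverse (a - 1) (b - 1) (c - 1) y = Gamma (c - 1) / (Gamma (a - 1) * Gamma (C + 1)) * P * (1 - y) * f2"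
      using 2 unfolding kummer_inverse_def e y1 by (simp add: f2_def P_def mult_ac)
    moreover have "Gamma c / (Gamma a * Gamma C) * P * (y * f1 + (1 - a) / C * (1 - y) * f2) = (c - 1) *
       (Gamma (c - 1) / (Gamma a * Gamma C) * P * y * f1 - Gamma (c - 1) / (Gamma (a - 1) * Gamma (C + 1)) * P * (1 - y) * f2)"
      unfolding Gp using G C by (simp add: divide_simps) (simp add: algebra_simps)
    ultimately show ?thesis by (simp only:)
  next
    case 3
    define w where "w = 1 / (1 - y)"
    have w: "0 < w" "w < 1" using 3 by (auto simp: w_def)
    define s where "s = sqrt (2 * pi) * rGamma (2 - b) * (1 / (1 - y) powr (b - 1))"
    \<comment> \<open>The functional equation of \<open>rGamma\<close> has no exceptional points, so
      integer b needs no separate treatment; its factor 1 - b matches the factor A = b - 1 in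
      \<open>gauss_F_contiguous_1\<close>.\<close>
    have r: "rGamma (1 - b) = (1 - b) * rGamma (2 - b)"
      using rGamma_plus1[of "1 - b"] by simp
    have pw: "1 / (1 - y) powr b = 1 / (1 - y) powr (b - 1) * w"
      using 3 by (simp add: w_def powr_diff)
    have F: "(c - 1) * (gauss_F (b - 1) (c - a - 1) (c - 1) w - gauss_F (b - 1) (c - a) (c - 1) w) = - ((b - 1) * w * gauss_F b (c - a) c w)"
      using gauss_F_contiguous_1[of c w "b - 1" "c - a"] w assms by simp
    have e: "1 - (b - 1) = 2 - b" "c - 1 - (a - 1) = c - a" "c - 1 - a = c - a - 1" by simp_all
    have "kummer_inverse a b c y = sqrt (2 * pi) * rGamma (1 - b) * (1 / (1 - y) powr b) * gauss_F b (c - a) c w"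
      using 3 by (simp add: kummer_inverse_def w_def)
    also have "\<dots> = s * (- ((b - 1) * w * gauss_F b (c - a) c w))"
    proof -
      have "S * ((1 - b) * R) * (P * w) * G = S * R * P * (- ((b - 1) * w * G))" for S R P G :: real
        by (simp add: algebra_simps)
      then show ?thesis unfolding r pw s_def .
    qed
    also have "\<dots> = (c - 1) * (s * gauss_F (b - 1) (c - a - 1) (c - 1) w - s * gauss_F (b - 1) (c - a) (c - 1) w)"
      unfolding F[symmetric] by (simp add: algebra_simps)
    also have "\<dots> = (c - 1) * (kummer_inverse a (b - 1) (c - 1) y - kummer_inverse (a - 1) (b - 1) (c - 1) y)"
      using 3 by (simp add: kummer_inverse_def e s_def flip: w_def)
    finally show ?thesis .
  qed
qed

text \<open>Induction on an integer bound of \<open>b\<close>, with all three parameters generalised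
  because the recursion also moves \<open>a\<close> and \<open>c\<close>.\<close>

lemma inverse_fourier_kummer_symbol:
  assumes "0 < b" "b < min a (c - a)" "y \<noteq> 0" "y \<noteq> 1"
  shows "inverse_fourier (kummer_symbol a b c) y = of_real (kummer_inverse a b c y)"
proof -
  have "inverse_fourier (kummer_symbol a b c) y = of_real (kummer_inverse a b c y)"
    if "0 < b" "b < min a (c - a)" "b \<le> real n" for n a b c
    using that
  proof (induction n arbitrary: a b c)
    case 0
    then show ?case by simp
  next
    case (Suc n)
    consider "b < 1" | "b = 1" | "b > 1" by linarith
    then show ?case
    proof cases
      case 1
      then show ?thesis using Suc.prems assms by (intro inverse_fourier_kummer_symbol_less_1) auto
    next
      case 2
      then show ?thesis using Suc.prems assms by (simp add: inverse_fourier_kummer_symbol_eq_1)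
    next
      case 3
      have "inverse_fourier (kummer_symbol a (b - 1) (c - 1)) y = of_real (kummer_inverse a (b - 1) (c - 1) y)"
        by (rule Suc.IH) (use 3 Suc.prems in auto)
      moreover have "inverse_fourier (kummer_symbol (a - 1) (b - 1) (c - 1)) y = of_real (kummer_inverse (a - 1) (b - 1) (c - 1) y)"
        by (rule Suc.IH) (use 3 Suc.prems in auto)
      ultimately show ?thesis
        using inverse_fourier_kummer_symbol_contiguous[of b a c y] kummer_inverse_contiguous[of b a c y] 3 Suc.prems assms
        by simp
    qed
  qed
  from this[OF assms(1,2) real_nat_ceiling_ge] show ?thesis .
qed

text \<open>The integrability clause guarantees that the integral in \<open>inverse_fourier\<close>
  is genuine, and not the default value 0 of a non-integrable function.\<close>

theorem mainTheorem7:
  fixes a b c :: real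
  assumes "0 < b" and "b < min a (c - a)"
  shows "(\<forall>y. integrable lborel (fourier_integrand (kummer_symbol a b c) y)) \<and>
    (\<forall>y. y > 1 \<longrightarrow> inverse_fourier (kummer_symbol a b c) y = 0) \<and>
    (\<forall>y. 0 < y \<and> y < 1 \<longrightarrow>
       inverse_fourier (kummer_symbol a b c) y =
         of_real (sqrt (2 * pi) * (Gamma c / (Gamma a * Gamma (1 - a - b + c)))
           * y powr (a - b) * (1 - y) powr (c - a - b)
           * gauss_F (1 - b) (c - b) (c + 1 - a - b) (1 - y))) \<and>
    (\<forall>y. y < 0 \<longrightarrow>
       inverse_fourier (kummer_symbol a b c) y =
         of_real (sqrt (2 * pi) * rGamma (1 - b) * (1 / (1 - y) powr b)
           * gauss_F b (c - a) c (1 / (1 - y))))"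
proof (intro conjI allI impI)
  fix y :: real
  show "integrable lborel (fourier_integrand (kummer_symbol a b c) y)"
    using assms by (intro integrable_fourier_integrand integrable_kummer_symbol)
next
  fix y :: real
  assume "y > 1"
  then show "inverse_fourier (kummer_symbol a b c) y = 0"
    using inverse_fourier_kummer_symbol[OF assms, of y] by (simp add: kummer_inverse_def)
next
  fix y :: real
  assume "0 < y \<and> y < 1"
  then show "inverse_fourier (kummer_symbol a b c) y =
         of_real (sqrt (2 * pi) * (Gamma c / (Gamma a * Gamma (1 - a - b + c)))
           * y powr (a - b) * (1 - y) powr (c - a - b)
           * gauss_F (1 - b) (c - b) (c + 1 - a - b) (1 - y))"
    using inverse_fourier_kummer_symbol[OF assms, of y] by (simp add: kummer_inverse_def)
next
  fix y :: real
  assume "y < 0"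
  then show "inverse_fourier (kummer_symbol a b c) y =
         of_real (sqrt (2 * pi) * rGamma (1 - b) * (1 / (1 - y) powr b)
           * gauss_F b (c - a) c (1 / (1 - y)))"
    using inverse_fourier_kummer_symbol[OF assms, of y] by (simp add: kummer_inverse_def)
qed

end
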